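(* Let $d\ge1$ be an integer. For $k\in\mathbb{R}^d\setminus\{0\}$, integer $m>0$ and real $\varepsilon>0$, let $$v_{k,m,\varepsilon}(x)=\varepsilon|k|^{-m}e^{-x^2/2}\cos(kx),\qquad x\in\mathbb{R}^d.$$ Then the following hold. (i) For any $\sigma>\frac12$ there is $N'=N'(d,\sigma)>0$ such that, for all such $k,m,\varepsilon$, the function $v=v_{k,m,\varepsilon}$ satisfies $Q_v(\lambda)\le N\exp(\sigma\lambda^2)$ for all $\lambda\ge0$, with $N=\varepsilon|k|^{-m}N'(d,\sigma)$. (ii) For any fixed $\sigma>\frac12$, integer $m>0$ and reals $\gamma_0,\gamma_1,\gamma_2>0$, for all sufficiently small $\varepsilon>0$ and all $|k|>1$, one has $N\le\gamma_0$ (with $N$ as in (i)), $\|v_{k,m,\varepsilon}\|_{\mathcal{W}^m(\mathbb{R}^d)}\le\gamma_1$ and $\|v_{k,m,\varepsilon}\|_{\mathcal{H}^m(\mathbb{R}^d)}\le\gamma_2$. (iii) For fixed $r>0$, integer $m>0$ and $\varepsilon>0$, as $|k|\to+\infty$: $\|\mathcal{F}v_{k,m,\varepsilon}\|_{L^\infty(B_r)}=O(\exp(-\alpha|k|^2))$ for any $\alpha\in(0,\frac12)$; $\|v_{k,m,\varepsilon}\|_{L^\infty(\mathbb{R}^d)}=\varepsilon|k|^{-m}$; and $\|v_{k,m,\varepsilon}\|_{L^2(\mathbb{R}^d)}=\Omega(|k|^{-m})$. (iv) For any fixed $r>0$, integer $m>0$, $\varepsilon>0$, exponents $\beta_1,\beta_2>m/2$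 and constants $c_1,c_2>0$, for all $k$ with $|k|$ sufficiently large, $$\|v_{k,m,\varepsilon}\|_{L^\infty(\mathbb{R}^d)}>c_1\left(\ln\left(3+\|\mathcal{F}v_{k,m,\varepsilon}\|_{L^\infty(B_r)}^{-1}\right)\right)^{-\beta_1},$$ $$\|v_{k,m,\varepsilon}\|_{L^2(\mathbb{R}^d)}>c_2\left(\ln\left(3+\|\mathcal{F}v_{k,m,\varepsilon}\|_{L^\infty(B_r)}^{-1}\right)\right)^{-\beta_2}.$$
   Context: Here $kx$ denotes the Euclidean inner product and $x^2=|x|^2$. Fourier transforms: $\mathcal{F}v(\xi)=\frac{1}{(2\pi)^d}\int_{\mathbb{R}^d}e^{i\xi x}v(x)\,dx$ and $\mathcal{F}^{-1}[u](x)=\int_{\mathbb{R}^d}u(\xi)e^{-i\xi x}\,d\xi$. $B_r=\{\xi\in\mathbb{R}^d:|\xi|<r\}$. $Q_v(\lambda)=\frac{1}{(2\pi)^d}\int_{\mathbb{R}^d}e^{\lambda|x|}|v(x)|\,dx$. $\mathcal{W}^m(\mathbb{R}^d)=\{u\in L^1(\mathbb{R}^d):(1+|\xi|^2)^{m/2}\mathcal{F}u\in L^\infty(\mathbb{R}^d)\}$ with norm $\|(1+|\xi|^2)^{m/2}\mathcal{F}u\|_{L^\infty(\mathbb{R}^d)}$. $\mathcal{H}^m(\mathbb{R}^d)=\{u\in L^2(\mathbb{R}^d):\mathcal{F}^{-1}(1+|\xi|^2)^{m/2}\mathcal{F}u\in L^2(\mathbb{R}^d)\}$ with norm $\|\mathcal{F}^{-1}(1+|\xi|^2)^{m/2}\mathcal{F}u\|_{L^2(\mathbb{R}^d)}$.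 For real quantities $a,b$ depending on $k$, $a=\Omega(b)$ means $a>0$ always and $b=O(a)$ as $|k|\to+\infty$. *)

theory Defs
  imports "HOL-Probability.Essential_Supremum" "HOL-Library.Landau_Symbols"
begin

text \<open>
  Function spaces over Lebesgue measure are represented by Borel functions on \<^const>\<open>lborel\<close>, without
  passing to the quotient by almost-everywhere equality; every class of Lebesgue measurable functions
  has a Borel representative. The real-valued norms below are meaningful only on members of the
  corresponding space (they are 0 outside it, or unspecified), so they are to be used together with
  membership.
\<close>

definition Linf :: "'a::euclidean_space set \<Rightarrow> ('a \<Rightarrow> 'b::real_normed_vector) set" where
  "Linf S = {f. f \<in> borel_measurable (restrict_space lborel S) \<and>
                esssup (restrict_space lborel S) (\<lambda>x. ennreal (norm (f x))) < \<infinity>}"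

definition Linf_norm :: "'a::euclidean_space set \<Rightarrow> ('a \<Rightarrow> 'b::real_normed_vector) \<Rightarrow> real" where
  "Linf_norm S f = enn2real (esssup (restrict_space lborel S) (\<lambda>x. ennreal (norm (f x))))"

definition L2 :: "('a::euclidean_space \<Rightarrow> 'b::real_normed_vector) set" where
  "L2 = {f. f \<in> borel_measurable lborel \<and> integrable lborel (\<lambda>x. (norm (f x))\<^sup>2)}"

definition L2_norm :: "('a::euclidean_space \<Rightarrow> 'b::real_normed_vector) \<Rightarrow> real" where
  "L2_norm f = sqrt (\<integral>x. (norm (f x))\<^sup>2 \<partial>lborel)"

definition fourier :: "('a::euclidean_space \<Rightarrow> complex) \<Rightarrow> 'a \<Rightarrow> complex" where
  "fourier v \<xi> = complex_of_real (1 / (2 * pi) ^ DIM('a)) *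
                   (\<integral>x. exp (\<i> * complex_of_real (\<xi> \<bullet> x)) * v x \<partial>lborel)"

definition inv_fourier :: "('a::euclidean_space \<Rightarrow> complex) \<Rightarrow> 'a \<Rightarrow> complex" where
  "inv_fourier u x = (\<integral>\<xi>. u \<xi> * exp (- \<i> * complex_of_real (\<xi> \<bullet> x)) \<partial>lborel)"

text \<open>
  On \<^const>\<open>L2\<close> the integrals above need not converge; as usual, the transforms are there the limits
  in the mean of the transforms of the truncations to balls of radius \<open>R \<rightarrow> \<infinity>\<close>. The limit is
  unique up to almost-everywhere equality, and \<open>SOME\<close> picks a representative.
\<close>

definition limit_in_mean ::
  "(('a::euclidean_space \<Rightarrow> complex) \<Rightarrow> 'a \<Rightarrow> complex) \<Rightarrow> ('a \<Rightarrow> complex) \<Rightarrow> ('a \<Rightarrow> complex) \<Rightarrow> bool" where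
  "limit_in_mean T u g \<longleftrightarrow> g \<in> L2 \<and>
     ((\<lambda>R::real. \<integral>\<^sup>+\<xi>. ennreal ((norm (T (\<lambda>x. indicator (ball 0 R) x * u x) \<xi> - g \<xi>))\<^sup>2) \<partial>lborel)
        \<longlongrightarrow> 0) at_top"

definition fourier_L2 :: "('a::euclidean_space \<Rightarrow> complex) \<Rightarrow> 'a \<Rightarrow> complex" where
  "fourier_L2 u = (SOME g. limit_in_mean fourier u g)"

definition inv_fourier_L2 :: "('a::euclidean_space \<Rightarrow> complex) \<Rightarrow> 'a \<Rightarrow> complex" where
  "inv_fourier_L2 u = (SOME g. limit_in_mean inv_fourier u g)"

definition bracket_weight :: "nat \<Rightarrow> 'a::euclidean_space \<Rightarrow> complex" where
  "bracket_weight m \<xi> = complex_of_real ((1 + (norm \<xi>)\<^sup>2) powr (real m / 2))"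

definition W_space :: "nat \<Rightarrow> ('a::euclidean_space \<Rightarrow> complex) set" where
  "W_space m = {u. integrable lborel u \<and> (\<lambda>\<xi>. bracket_weight m \<xi> * fourier u \<xi>) \<in> Linf UNIV}"

definition W_norm :: "nat \<Rightarrow> ('a::euclidean_space \<Rightarrow> complex) \<Rightarrow> real" where
  "W_norm m u = Linf_norm UNIV (\<lambda>\<xi>. bracket_weight m \<xi> * fourier u \<xi>)"

text \<open>
  By Plancherel, the inverse transform of a tempered distribution lies in \<^const>\<open>L2\<close> exactly if the
  distribution itself does. Since \<^const>\<open>inv_fourier_L2\<close> is only meaningful on \<^const>\<open>L2\<close>, this
  condition on its argument is part of the definition of the space.
\<close>

definition H_space :: "nat \<Rightarrow> ('a::euclidean_space \<Rightarrow> complex) set" where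
  "H_space m = {u. u \<in> L2 \<and> (\<lambda>\<xi>. bracket_weight m \<xi> * fourier_L2 u \<xi>) \<in> L2 \<and>
                   inv_fourier_L2 (\<lambda>\<xi>. bracket_weight m \<xi> * fourier_L2 u \<xi>) \<in> L2}"

definition H_norm :: "nat \<Rightarrow> ('a::euclidean_space \<Rightarrow> complex) \<Rightarrow> real" where
  "H_norm m u = L2_norm (inv_fourier_L2 (\<lambda>\<xi>. bracket_weight m \<xi> * fourier_L2 u \<xi>))"

definition Q :: "('a::euclidean_space \<Rightarrow> complex) \<Rightarrow> real \<Rightarrow> ennreal" where
  "Q v t = ennreal (1 / (2 * pi) ^ DIM('a)) *
            (\<integral>\<^sup>+x. ennreal (exp (t * norm x) * norm (v x)) \<partial>lborel)"

text \<open>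
  The relation \<open>a = \<Omega>(b)\<close> for quantities depending on \<open>k \<noteq> 0\<close>, as \<open>|k| \<rightarrow> \<infinity>\<close>: besides
  the library's \<open>\<Omega>\<close>, it includes positivity of \<open>a\<close> for all parameters.
\<close>

definition is_Omega :: "('a::euclidean_space \<Rightarrow> real) \<Rightarrow> ('a \<Rightarrow> real) \<Rightarrow> bool" where
  "is_Omega a b \<longleftrightarrow> (\<forall>k. k \<noteq> 0 \<longrightarrow> a k > 0) \<and> b \<in> O[at_infinity](a)"

text \<open>The real-valued potential \<open>v\<^bsub>k,m,\<epsilon>\<^esub>\<close>, regarded as a complex function.\<close>

definition vpot :: "'a::euclidean_space \<Rightarrow> nat \<Rightarrow> real \<Rightarrow> 'a \<Rightarrow> complex" where
  "vpot k m \<epsilon> x = complex_of_real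
     (\<epsilon> * norm k powi (- int m) * exp (- (norm x)\<^sup>2 / 2) * cos (k \<bullet> x))"

end

theory Submission
  imports Defs "HOL-Probability.Characteristic_Functions"
begin

text \<open>
  The potential is a Gaussian of width 1, modulated at frequency \<open>k\<close>. Modulation is translation on
  the Fourier side: \<open>fourier v\<close> consists of two Gaussian bumps of width 1 centred at \<open>k\<close> and \<open>-k\<close>
  (\<open>fourier_vpot\<close>). The Sobolev norms and the low-frequency data are read off from this formula.

  A Sobolev weight of order \<open>m\<close> has size about \<open>|k|\<^sup>m\<close> on the bumps, which the amplitude \<open>\<epsilon>|k|\<^sup>-\<^sup>m\<close>
  compensates; hence the norms of order \<open>m\<close> are bounded by a multiple of \<open>\<epsilon>\<close>, uniformly in \<open>k\<close>
  (\<open>vpot_sobolev_bounds\<close>). A fixed ball around the origin meets only the tails of the bumps, so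
  low-frequency data of the potential are at most of size \<open>exp(-\<alpha>|k|\<^sup>2)\<close> for every \<open>\<alpha> < 1/2\<close>
  (\<open>fourier_vpot_Linf_ball\<close>), whereas
  its \<open>L\<^sup>\<infinity>\<close> and \<open>L\<^sup>2\<close> norms are of order \<open>|k|\<^sup>-\<^sup>m\<close> (\<open>Linf_norm_vpot\<close>, \<open>L2_norm_vpot_ge\<close>). The logarithm of the inverse
  of the data thus grows at least like \<open>|k|\<^sup>2\<close>, and a power of it with exponent below \<open>-m/2\<close> is too
  small to dominate the norms (\<open>eventually_powr_ln_less\<close>).

  The norm of \<open>H_space\<close> involves transforms defined as limits in the mean. They are tied to convergent
  integrals through the inequality \<open>\<parallel>F u\<parallel> \<le> c \<parallel>u\<parallel>\<close> of \<open>L\<^sup>2\<close> norms for integrable \<open>u\<close>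
  (\<open>raw_fourier_L2_bound\<close>), which is proved by damping with a Gaussian. It shows both that the integrals are
  such limits and that the outer inverse transform does not increase the norm beyond a constant
  factor (\<open>H_space_criterion\<close>).
\<close>

section \<open>The Fourier transform of a Gaussian\<close>

lemma has_bochner_integral_prod_Basis:
  fixes f :: "'a::euclidean_space \<Rightarrow> real \<Rightarrow> 'b::{real_normed_field,banach,second_countable_topology}"
  assumes f: "\<And>b. b \<in> Basis \<Longrightarrow> has_bochner_integral lborel (f b) (I b)"
  shows "has_bochner_integral lborel (\<lambda>x. \<Prod>b\<in>Basis. f b (x \<bullet> b)) (\<Prod>b\<in>Basis. I b)"
proof -
  interpret product_sigma_finite "\<lambda>b::'a. lborel :: real measure" ..
  have int: "\<And>b. b \<in> Basis \<Longrightarrow> integrable lborel (f b)"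
    and I: "\<And>b. b \<in> Basis \<Longrightarrow> integral\<^sup>L lborel (f b) = I b"
    using f by (auto simp: has_bochner_integral_iff)
  have [measurable]: "\<And>b. b \<in> Basis \<Longrightarrow> f b \<in> borel_measurable borel"
    using int by (auto dest: borel_measurable_integrable)
  let ?T = "\<lambda>f. \<Sum>b\<in>Basis. f b *\<^sub>R b :: 'a"
  have T: "?T \<in> measurable (\<Pi>\<^sub>M b\<in>Basis. lborel) borel" by measurable
  have m: "(\<lambda>x. \<Prod>b\<in>Basis. f b (x \<bullet> b)) \<in> borel_measurable (borel :: 'a measure)" by measurable
  have *: "(\<lambda>x. \<Prod>b\<in>Basis. f b (?T x \<bullet> b)) = (\<lambda>x. \<Prod>b\<in>Basis. f b (x b))"
    by (intro ext prod.cong) auto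
  show ?thesis
    unfolding has_bochner_integral_iff
    by (subst (1 2) lborel_eq)
       (use product_integrable_prod[OF finite_Basis int] product_integral_prod[OF finite_Basis int] I in
         \<open>simp add: integrable_distr_eq[OF T m] integral_distr[OF T m] *\<close>)
qed

text \<open>
  The integral is the characteristic function of the standard normal distribution without its
  normalising factor.
\<close>

lemma gaussian_iexp_real:
  fixes t :: real
  shows "has_bochner_integral lborel (\<lambda>x. iexp (t * x) * complex_of_real (exp (- x\<^sup>2 / 2)))
           (complex_of_real (sqrt (2 * pi) * exp (- t\<^sup>2 / 2)))"
proof -
  have i: "integrable lborel (\<lambda>x. std_normal_density x)"
    using integrable_std_normal_moment[of 0] by simp
  have i': "integrable lborel (\<lambda>x. std_normal_density x *\<^sub>R iexp (t * x))"
    by (rule Bochner_Integration.integrable_bound[OF i]) (auto)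
  have "(\<integral>x. std_normal_density x *\<^sub>R iexp (t * x) \<partial>lborel) = char std_normal_distribution t"
    unfolding char_def by (subst integral_density) auto
  also have "\<dots> = complex_of_real (exp (- t\<^sup>2 / 2))" by (simp add: char_std_normal_distribution)
  finally have "has_bochner_integral lborel (\<lambda>x. complex_of_real (sqrt (2*pi)) * (std_normal_density x *\<^sub>R iexp (t * x)))
     (complex_of_real (sqrt (2*pi)) * complex_of_real (exp (- t\<^sup>2 / 2)))"
    using i' by (intro has_bochner_integral_mult_right) (simp add: has_bochner_integral_iff)
  moreover have "(\<lambda>x. complex_of_real (sqrt (2*pi)) * (std_normal_density x *\<^sub>R iexp (t * x)))
      = (\<lambda>x. iexp (t * x) * complex_of_real (exp (- x\<^sup>2 / 2)))"
    by (auto simp: std_normal_density_def scaleR_conv_of_real)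
  ultimately show ?thesis by simp
qed

lemma gaussian_iexp_real_scaled:
  fixes a t :: real
  assumes "a > 0"
  shows "has_bochner_integral lborel (\<lambda>x. iexp (t * x) * complex_of_real (exp (- a * x\<^sup>2 / 2)))
           (complex_of_real (sqrt (2 * pi / a) * exp (- t\<^sup>2 / (2 * a))))"
proof -
  have "has_bochner_integral lborel (\<lambda>x. iexp (t / sqrt a * (0 + sqrt a * x))
            * complex_of_real (exp (- (0 + sqrt a * x)\<^sup>2 / 2)))
         (complex_of_real (sqrt (2 * pi) * exp (- (t / sqrt a)\<^sup>2 / 2)) /\<^sub>R \<bar>sqrt a\<bar>)"
    using gaussian_iexp_real[of "t / sqrt a"] assms
    by (subst lborel_has_bochner_integral_real_affine_iff[symmetric]) auto
  also have "(\<lambda>x. iexp (t / sqrt a * (0 + sqrt a * x))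
            * complex_of_real (exp (- (0 + sqrt a * x)\<^sup>2 / 2)))
       = (\<lambda>x. iexp (t * x) * complex_of_real (exp (- a * x\<^sup>2 / 2)))"
    using assms by (auto simp: power_mult_distrib)
  also have "complex_of_real (sqrt (2 * pi) * exp (- (t / sqrt a)\<^sup>2 / 2)) /\<^sub>R \<bar>sqrt a\<bar>
      = complex_of_real (sqrt (2 * pi / a) * exp (- t\<^sup>2 / (2 * a)))"
    using assms by (simp add: scaleR_conv_of_real real_sqrt_divide power_divide field_simps)
  finally show ?thesis .
qed

lemma norm_power2_eq_sum_Basis: "(norm x)\<^sup>2 = (\<Sum>b\<in>Basis. (x \<bullet> b)\<^sup>2)" for x :: "'a::euclidean_space"
  unfolding power2_norm_eq_inner by (subst euclidean_inner) (simp add: power2_eq_square)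

text \<open>
  Both the Gaussian and the character factor over the coordinates, so the one-dimensional formula
  gives the result in every dimension.
\<close>

lemma gaussian_iexp:
  fixes \<xi> :: "'a::euclidean_space" and a :: real
  assumes "a > 0"
  shows "has_bochner_integral lborel (\<lambda>x. iexp (\<xi> \<bullet> x) * complex_of_real (exp (- a * (norm x)\<^sup>2 / 2)))
           (complex_of_real (sqrt (2 * pi / a) ^ DIM('a) * exp (- (norm \<xi>)\<^sup>2 / (2 * a))))"
proof -
  have "has_bochner_integral lborel
      (\<lambda>x::'a. \<Prod>b\<in>Basis. iexp ((\<xi> \<bullet> b) * (x \<bullet> b)) * complex_of_real (exp (- a * (x \<bullet> b)\<^sup>2 / 2)))
      (\<Prod>b\<in>(Basis::'a set). complex_of_real (sqrt (2 * pi / a) * exp (- (\<xi> \<bullet> b)\<^sup>2 / (2 * a))))"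
    by (intro has_bochner_integral_prod_Basis gaussian_iexp_real_scaled assms)
  also have "(\<lambda>x::'a. \<Prod>b\<in>Basis. iexp ((\<xi> \<bullet> b) * (x \<bullet> b)) * complex_of_real (exp (- a * (x \<bullet> b)\<^sup>2 / 2)))
     = (\<lambda>x. iexp (\<xi> \<bullet> x) * complex_of_real (exp (- a * (norm x)\<^sup>2 / 2)))"
  proof
    fix x :: 'a
    have "(\<Prod>b\<in>Basis. iexp ((\<xi> \<bullet> b) * (x \<bullet> b))) = iexp (\<xi> \<bullet> x)"
      by (subst euclidean_inner[of \<xi> x]) (simp add: exp_sum sum_distrib_left)
    moreover have "(\<Prod>b\<in>Basis. exp (- a * (x \<bullet> b)\<^sup>2 / 2)) = exp (- a * (norm x)\<^sup>2 / 2)"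
      by (subst norm_power2_eq_sum_Basis[of x])
         (simp add: exp_sum[symmetric] sum_distrib_left sum_divide_distrib sum_negf)
    ultimately show "(\<Prod>b\<in>Basis. iexp ((\<xi> \<bullet> b) * (x \<bullet> b)) * complex_of_real (exp (- a * (x \<bullet> b)\<^sup>2 / 2)))
       = iexp (\<xi> \<bullet> x) * complex_of_real (exp (- a * (norm x)\<^sup>2 / 2))"
      by (simp add: prod.distrib of_real_prod[symmetric] del: of_real_prod)
  qed
  also have "(\<Prod>b\<in>(Basis::'a set). complex_of_real (sqrt (2 * pi / a) * exp (- (\<xi> \<bullet> b)\<^sup>2 / (2 * a))))
     = complex_of_real (sqrt (2 * pi / a) ^ DIM('a) * exp (- (norm \<xi>)\<^sup>2 / (2 * a)))"
    by (subst norm_power2_eq_sum_Basis[of \<xi>])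
       (simp add: prod.distrib exp_sum[symmetric] sum_divide_distrib sum_negf of_real_prod[symmetric] del: of_real_prod of_real_mult)
  finally show ?thesis .
qed

lemma gaussian_integral:
  fixes a :: real
  assumes "a > 0"
  shows "has_bochner_integral lborel (\<lambda>x::'a::euclidean_space. exp (- a * (norm x)\<^sup>2 / 2)) (sqrt (2 * pi / a) ^ DIM('a))"
  using has_bochner_integral_Re[OF gaussian_iexp[OF assms, of "0::'a"]] by simp

section \<open>The Bessel inequality for the Fourier transform\<close>

lemma (in pair_sigma_finite) integrable_product:
  fixes f :: "'a \<Rightarrow> 'c::{real_normed_field,banach,second_countable_topology}" and g :: "'b \<Rightarrow> 'c"
  assumes f: "integrable M1 f" and g: "integrable M2 g"
  shows "integrable (M1 \<Otimes>\<^sub>M M2) (\<lambda>z. f (fst z) * g (snd z))"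
proof (rule Fubini_integrable)
  have [measurable]: "f \<in> borel_measurable M1" "g \<in> borel_measurable M2"
    using f g by auto
  show "(\<lambda>z. f (fst z) * g (snd z)) \<in> borel_measurable (M1 \<Otimes>\<^sub>M M2)" by measurable
  show "integrable M1 (\<lambda>x. \<integral>y. norm (f (fst (x, y)) * g (snd (x, y))) \<partial>M2)"
    using f by (simp add: norm_mult)
  show "AE x in M1. integrable M2 (\<lambda>y. f (fst (x, y)) * g (snd (x, y)))"
    using g by simp
qed

text \<open>
  The oscillatory integral without normalising constant. The transform and its inverse differ from
  it only by a constant and a reflection of the argument.
\<close>

definition raw_fourier :: "('a::euclidean_space \<Rightarrow> complex) \<Rightarrow> 'a \<Rightarrow> complex" where
  "raw_fourier u \<xi> = (\<integral>x. iexp (\<xi> \<bullet> x) * u x \<partial>lborel)"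

lemma borel_measurable_raw_fourier [measurable]:
  fixes u :: "'a::euclidean_space \<Rightarrow> complex"
  assumes [measurable]: "u \<in> borel_measurable borel"
  shows "raw_fourier u \<in> borel_measurable borel"
  unfolding raw_fourier_def by measurable

lemma integrable_iexp_mult:
  fixes u :: "'a::euclidean_space \<Rightarrow> complex"
  assumes u: "integrable lborel u"
  shows "integrable lborel (\<lambda>x. iexp (\<xi> \<bullet> x) * u x)"
proof (rule Bochner_Integration.integrable_bound[OF u])
  have [measurable]: "u \<in> borel_measurable borel" using u by auto
  show "(\<lambda>x. iexp (\<xi> \<bullet> x) * u x) \<in> borel_measurable lborel" by measurable
qed (simp add: norm_mult)

lemma nn_integral_gaussian_translate:
  fixes x :: "'a::euclidean_space"
  assumes "a > 0"
  shows "(\<integral>\<^sup>+y. ennreal (exp (- a * (norm (x - y))\<^sup>2 / 2)) \<partial>lborel) = ennreal (sqrt (2 * pi / a) ^ DIM('a))"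
proof -
  have "(\<integral>\<^sup>+y. ennreal (exp (- a * (norm (x - y))\<^sup>2 / 2)) \<partial>lborel)
     = (\<integral>\<^sup>+y. ennreal (exp (- a * (norm (x - y))\<^sup>2 / 2)) \<partial>distr lborel borel ((+) x))"
    by (simp add: lborel_distr_plus)
  also have "\<dots> = (\<integral>\<^sup>+y. ennreal (exp (- a * (norm y)\<^sup>2 / 2)) \<partial>(lborel :: 'a measure))"
    by (subst nn_integral_distr) simp_all
  also have "\<dots> = ennreal (sqrt (2 * pi / a) ^ DIM('a))"
    using gaussian_integral[OF assms, where 'a='a]
    by (simp add: has_bochner_integral_iff nn_integral_eq_integral)
  finally show ?thesis .
qed

lemma raw_fourier_times_cnj:
  fixes u :: "'a::euclidean_space \<Rightarrow> complex"
  assumes u: "integrable lborel u"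
  shows "raw_fourier u \<xi> * cnj (raw_fourier u \<xi>)
    = (\<integral>z. u (fst z) * cnj (u (snd z)) * iexp (\<xi> \<bullet> (fst z - snd z)) \<partial>(lborel \<Otimes>\<^sub>M lborel))"
proof -
  let ?f = "\<lambda>x. iexp (\<xi> \<bullet> x) * u x"
  have f: "integrable lborel ?f" using u by (rule integrable_iexp_mult)
  then have f': "integrable lborel (\<lambda>x. cnj (?f x))" by (simp only: integrable_cnj)
  have "raw_fourier u \<xi> * cnj (raw_fourier u \<xi>) = (\<integral>x. ?f x \<partial>lborel) * (\<integral>y. cnj (?f y) \<partial>lborel)"
    unfolding raw_fourier_def Bochner_Integration.integral_cnj ..
  also have "\<dots> = (\<integral>x. \<integral>y. ?f x * cnj (?f y) \<partial>lborel \<partial>lborel)"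
    by simp
  also have "\<dots> = (\<integral>z. ?f (fst z) * cnj (?f (snd z)) \<partial>(lborel \<Otimes>\<^sub>M lborel))"
    using lborel_pair.integral_fst'[OF lborel_pair.integrable_product[OF f f']] by simp
  also have "\<dots> = (\<integral>z. u (fst z) * cnj (u (snd z)) * iexp (\<xi> \<bullet> (fst z - snd z)) \<partial>(lborel \<Otimes>\<^sub>M lborel))"
    by (intro Bochner_Integration.integral_cong refl)
       (simp add: exp_cnj inner_diff_right exp_diff exp_minus field_simps)
  finally show ?thesis .
qed

text \<open>
  The Gaussian factor makes Fubini applicable to \<open>\<integral>|Fu|\<^sup>2\<close>: expanding the square and
  integrating over \<open>\<xi>\<close> first leaves \<open>\<integral>\<integral> u(x) cnj(u(y)) G(x - y) dx dy\<close>, where \<open>G\<close> is the Fourier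
  transform of the damping factor. As \<open>G\<close> is even, nonnegative and of total mass \<open>(2\<pi>)\<^sup>d\<close> whatever \<open>a\<close> is,
  the inequality \<open>|u(x) u(y)| \<le> (|u(x)|\<^sup>2 + |u(y)|\<^sup>2) / 2\<close> bounds the double integral.
\<close>

lemma raw_fourier_gaussian_damped_bound:
  fixes u :: "'a::euclidean_space \<Rightarrow> complex" and a :: real
  assumes u: "integrable lborel u" and a: "a > 0"
  shows "(\<integral>\<^sup>+\<xi>. ennreal ((norm (raw_fourier u \<xi>))\<^sup>2 * exp (- a * (norm \<xi>)\<^sup>2 / 2)) \<partial>lborel)
     \<le> ennreal ((2 * pi) ^ DIM('a)) * (\<integral>\<^sup>+x. ennreal ((norm (u x))\<^sup>2) \<partial>lborel)"
proof -
  have [measurable]: "u \<in> borel_measurable borel" using u by auto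
  define g where "g \<xi> = exp (- a * (norm \<xi>)\<^sup>2 / 2)" for \<xi> :: 'a
  define K where "K = sqrt (2 * pi / a) ^ DIM('a)"
  define G where "G z = K * exp (- (1/a) * (norm z)\<^sup>2 / 2)" for z :: 'a
  define U where "U z = u (fst z) * cnj (u (snd z))" for z
  have [measurable]: "g \<in> borel_measurable borel" "G \<in> borel_measurable borel"
    unfolding g_def G_def by measurable
  have K0: "K \<ge> 0" unfolding K_def using a by simp
  have G0: "G z \<ge> 0" for z unfolding G_def using K0 by simp
  have g0: "g z \<ge> 0" for z unfolding g_def by simp
  have G_hb: "has_bochner_integral lborel (\<lambda>\<xi>. iexp (\<xi> \<bullet> z) * complex_of_real (g \<xi>)) (complex_of_real (G z))" for z
    using gaussian_iexp[OF a, of z] unfolding g_def G_def K_def by (simp add: inner_commute mult.commute[of a 2])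
  have g_int: "integrable lborel (\<lambda>\<xi>. complex_of_real (g \<xi>))"
    using gaussian_integral[OF a, where 'a='a] unfolding g_def[symmetric]
    by (simp add: has_bochner_integral_iff)
  have U_int: "integrable (lborel \<Otimes>\<^sub>M lborel) U"
    unfolding U_def by (intro lborel_pair.integrable_product u) (simp add: u)
  then have U_int': "integrable lborel U" by (simp add: lborel_prod)
  have [measurable]: "U \<in> borel_measurable borel" using U_int' by auto
  define D where "D z = fst z - snd z" for z :: "'a \<times> 'a"
  have [measurable]: "D \<in> borel_measurable borel"
    unfolding D_def by (intro borel_measurable_continuous_onI continuous_intros)
  have int3: "integrable (lborel \<Otimes>\<^sub>M lborel) (\<lambda>(\<xi>, z). U z * (iexp (\<xi> \<bullet> (fst z - snd z)) * complex_of_real (g \<xi>)))"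
  proof (rule Bochner_Integration.integrable_bound[OF lborel_pair.integrable_product[OF g_int U_int']])
    show "(\<lambda>(\<xi>, z). U z * (iexp (\<xi> \<bullet> (fst z - snd z)) * complex_of_real (g \<xi>)))
        \<in> borel_measurable (lborel \<Otimes>\<^sub>M lborel)"
      unfolding case_prod_beta D_def[symmetric] by measurable
  qed (auto simp: norm_mult mult_ac)
  have E: "complex_of_real ((norm (raw_fourier u \<xi>))\<^sup>2 * g \<xi>)
      = (\<integral>z. U z * (iexp (\<xi> \<bullet> (fst z - snd z)) * complex_of_real (g \<xi>)) \<partial>lborel)" for \<xi>
  proof -
    have "complex_of_real ((norm (raw_fourier u \<xi>))\<^sup>2 * g \<xi>) = raw_fourier u \<xi> * cnj (raw_fourier u \<xi>) * complex_of_real (g \<xi>)"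
      by (simp add: complex_norm_square[symmetric])
    also have "\<dots> = (\<integral>z. U z * (iexp (\<xi> \<bullet> (fst z - snd z))) * complex_of_real (g \<xi>) \<partial>lborel)"
      unfolding raw_fourier_times_cnj[OF u] U_def lborel_prod by simp
    finally show ?thesis by (simp add: mult_ac)
  qed
  have int: "integrable lborel (\<lambda>\<xi>. complex_of_real ((norm (raw_fourier u \<xi>))\<^sup>2 * g \<xi>))"
    using lborel_pair.integrable_fst[OF int3] unfolding E .
  then have intR: "integrable lborel (\<lambda>\<xi>. (norm (raw_fourier u \<xi>))\<^sup>2 * g \<xi>)"
    by (simp only: complex_of_real_integrable_eq)
  have "complex_of_real (\<integral>\<xi>. (norm (raw_fourier u \<xi>))\<^sup>2 * g \<xi> \<partial>lborel)
      = (\<integral>\<xi>. complex_of_real ((norm (raw_fourier u \<xi>))\<^sup>2 * g \<xi>) \<partial>lborel)"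
    by (rule integral_complex_of_real[symmetric])
  also have "\<dots> = (\<integral>\<xi>. \<integral>z. U z * (iexp (\<xi> \<bullet> (fst z - snd z)) * complex_of_real (g \<xi>)) \<partial>lborel \<partial>lborel)"
    unfolding E ..
  also have "\<dots> = (\<integral>z. \<integral>\<xi>. U z * (iexp (\<xi> \<bullet> (fst z - snd z)) * complex_of_real (g \<xi>)) \<partial>lborel \<partial>lborel)"
    by (rule lborel_pair.Fubini_integral[OF int3, symmetric])
  also have "\<dots> = (\<integral>z. U z * complex_of_real (G (fst z - snd z)) \<partial>lborel)"
    using G_hb by (simp add: has_bochner_integral_iff)
  finally have eq: "complex_of_real (\<integral>\<xi>. (norm (raw_fourier u \<xi>))\<^sup>2 * g \<xi> \<partial>lborel)
      = (\<integral>z. U z * complex_of_real (G (fst z - snd z)) \<partial>lborel)" .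
  have intUG: "integrable lborel (\<lambda>z. U z * complex_of_real (G (fst z - snd z)))"
  proof (rule Bochner_Integration.integrable_bound)
    show "integrable lborel (\<lambda>z. complex_of_real K * U z)" using U_int' by simp
    have "\<bar>G z\<bar> \<le> \<bar>K\<bar>" for z
      using K0 a by (simp add: G_def abs_mult mult_le_cancel_left2)
    then show "AE z in lborel. norm (U z * complex_of_real (G (fst z - snd z))) \<le> norm (complex_of_real K * U z)"
      by (auto simp: norm_mult mult.commute[of "\<bar>K\<bar>"] intro!: mult_left_mono)
    show "(\<lambda>z. U z * complex_of_real (G (fst z - snd z))) \<in> borel_measurable lborel"
      unfolding D_def[symmetric] by measurable
  qed
  have KG: "(\<integral>\<^sup>+y. ennreal (G (x - y)) \<partial>lborel) = ennreal ((2 * pi) ^ DIM('a))" for x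
  proof -
    have "(\<integral>\<^sup>+y. ennreal (G (x - y)) \<partial>lborel)
        = ennreal K * (\<integral>\<^sup>+y. ennreal (exp (- (1/a) * (norm (x - y))\<^sup>2 / 2)) \<partial>lborel)"
      unfolding G_def using K0 by (simp add: ennreal_mult nn_integral_cmult)
    also have "\<dots> = ennreal (K * sqrt (2 * pi / (1 / a)) ^ DIM('a))"
      using a K0 by (subst nn_integral_gaussian_translate) (auto simp: ennreal_mult)
    also have "K * sqrt (2 * pi / (1 / a)) ^ DIM('a) = (2 * pi) ^ DIM('a)"
    proof -
      have "2 * pi / a * (2 * pi / (1 / a)) = (2 * pi)\<^sup>2"
        using a by (simp add: power2_eq_square)
      then show ?thesis
        unfolding K_def power_mult_distrib[of _ _ "DIM('a)", symmetric] real_sqrt_mult[symmetric]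
        by (simp only: real_sqrt_abs) simp
    qed
    finally show ?thesis .
  qed
  have sym: "G (x - y) = G (y - x)" for x y
    by (simp add: G_def norm_minus_commute)
  let ?N = "\<integral>\<^sup>+x. ennreal ((norm (u x))\<^sup>2) \<partial>lborel"
  have "(\<integral>\<^sup>+\<xi>. ennreal ((norm (raw_fourier u \<xi>))\<^sup>2 * g \<xi>) \<partial>lborel) = ennreal (\<integral>\<xi>. (norm (raw_fourier u \<xi>))\<^sup>2 * g \<xi> \<partial>lborel)"
    using intR g0 by (intro nn_integral_eq_integral) auto
  also have "\<dots> \<le> ennreal (norm (\<integral>z. U z * complex_of_real (G (fst z - snd z)) \<partial>lborel))"
    unfolding eq[symmetric] norm_of_real by (intro ennreal_leI) simp
  also have "\<dots> \<le> (\<integral>\<^sup>+z. norm (U z * complex_of_real (G (fst z - snd z))) \<partial>lborel)"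
    by (rule integral_norm_bound_ennreal[OF intUG])
  also have "\<dots> \<le> (\<integral>\<^sup>+z. ennreal ((norm (u (fst z)))\<^sup>2 / 2) * ennreal (G (fst z - snd z))
         + ennreal ((norm (u (snd z)))\<^sup>2 / 2) * ennreal (G (fst z - snd z)) \<partial>lborel)"
  proof (rule nn_integral_mono)
    fix z :: "'a \<times> 'a"
    have "norm (u (fst z)) * norm (u (snd z)) \<le> (norm (u (fst z)))\<^sup>2 / 2 + (norm (u (snd z)))\<^sup>2 / 2"
      using sum_squares_bound[of "norm (u (fst z))" "norm (u (snd z))"] by simp
    then have "norm (U z * complex_of_real (G (fst z - snd z)))
        \<le> ((norm (u (fst z)))\<^sup>2 / 2 + (norm (u (snd z)))\<^sup>2 / 2) * G (fst z - snd z)"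
      using G0 unfolding U_def by (simp add: norm_mult mult_right_mono)
    then show "ennreal (norm (U z * complex_of_real (G (fst z - snd z))))
       \<le> ennreal ((norm (u (fst z)))\<^sup>2 / 2) * ennreal (G (fst z - snd z))
         + ennreal ((norm (u (snd z)))\<^sup>2 / 2) * ennreal (G (fst z - snd z))"
      using G0 by (simp add: ennreal_mult[symmetric] ennreal_plus[symmetric] distrib_right ennreal_leI del: ennreal_plus)
  qed
  also have "\<dots> = (\<integral>\<^sup>+z. ennreal ((norm (u (fst z)))\<^sup>2 / 2) * ennreal (G (fst z - snd z)) \<partial>(lborel \<Otimes>\<^sub>M lborel))
         + (\<integral>\<^sup>+z. ennreal ((norm (u (snd z)))\<^sup>2 / 2) * ennreal (G (fst z - snd z)) \<partial>(lborel \<Otimes>\<^sub>M lborel))"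
    unfolding lborel_prod[symmetric] by (rule nn_integral_add) measurable
  also have "(\<integral>\<^sup>+z. ennreal ((norm (u (fst z)))\<^sup>2 / 2) * ennreal (G (fst z - snd z)) \<partial>(lborel \<Otimes>\<^sub>M lborel))
       = (\<integral>\<^sup>+x. ennreal ((norm (u x))\<^sup>2 / 2) * ennreal ((2 * pi) ^ DIM('a)) \<partial>lborel)"
    by (subst lborel.nn_integral_fst[symmetric]) (auto simp: nn_integral_cmult KG)
  also have "(\<integral>\<^sup>+z. ennreal ((norm (u (snd z)))\<^sup>2 / 2) * ennreal (G (fst z - snd z)) \<partial>(lborel \<Otimes>\<^sub>M lborel))
       = (\<integral>\<^sup>+x. ennreal ((norm (u x))\<^sup>2 / 2) * ennreal ((2 * pi) ^ DIM('a)) \<partial>lborel)"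
    by (subst lborel_pair.nn_integral_snd[symmetric]) (auto simp: nn_integral_cmult KG sym[of _ "_::'a"] simp flip: sym)
  also have "(\<integral>\<^sup>+x. ennreal ((norm (u x))\<^sup>2 / 2) * ennreal ((2 * pi) ^ DIM('a)) \<partial>lborel)
      + (\<integral>\<^sup>+x. ennreal ((norm (u x))\<^sup>2 / 2) * ennreal ((2 * pi) ^ DIM('a)) \<partial>lborel)
      = (\<integral>\<^sup>+x. ennreal ((2 * pi) ^ DIM('a)) * ennreal ((norm (u x))\<^sup>2) \<partial>lborel)"
    by (subst nn_integral_add[symmetric])
       (auto intro!: nn_integral_cong simp: ennreal_mult[symmetric] ennreal_plus[symmetric] simp del: ennreal_plus)
  also have "\<dots> = ennreal ((2 * pi) ^ DIM('a)) * ?N"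
    by (rule nn_integral_cmult) measurable
  finally show ?thesis unfolding g_def .
qed

text \<open>
  The damped bound is uniform in \<open>a\<close>, so Fatou's lemma removes the damping as \<open>a \<rightarrow> 0\<close>. This
  is the inequality half of Plancherel's theorem.
\<close>

lemma raw_fourier_L2_bound:
  fixes u :: "'a::euclidean_space \<Rightarrow> complex"
  assumes u: "integrable lborel u"
  shows "(\<integral>\<^sup>+\<xi>. ennreal ((norm (raw_fourier u \<xi>))\<^sup>2) \<partial>lborel)
     \<le> ennreal ((2 * pi) ^ DIM('a)) * (\<integral>\<^sup>+x. ennreal ((norm (u x))\<^sup>2) \<partial>lborel)"
proof -
  have [measurable]: "u \<in> borel_measurable borel" using u by auto
  let ?f = "\<lambda>n \<xi>. ennreal ((norm (raw_fourier u \<xi>))\<^sup>2 * exp (- inverse (real (Suc n)) * (norm \<xi>)\<^sup>2 / 2))"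
  have "(\<lambda>n. ?f n \<xi>) \<longlonglongrightarrow> ennreal ((norm (raw_fourier u \<xi>))\<^sup>2 * exp (- 0 * (norm \<xi>)\<^sup>2 / 2))" for \<xi>
    by (intro tendsto_ennrealI tendsto_intros LIMSEQ_inverse_real_of_nat) auto
  then have "liminf (\<lambda>n. ?f n \<xi>) = ennreal ((norm (raw_fourier u \<xi>))\<^sup>2)" for \<xi>
    using lim_imp_Liminf[OF sequentially_bot] by fastforce
  then have "(\<integral>\<^sup>+\<xi>. ennreal ((norm (raw_fourier u \<xi>))\<^sup>2) \<partial>lborel) = (\<integral>\<^sup>+\<xi>. liminf (\<lambda>n. ?f n \<xi>) \<partial>lborel)"
    by simp
  also have "\<dots> \<le> liminf (\<lambda>n. \<integral>\<^sup>+\<xi>. ?f n \<xi> \<partial>lborel)"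
    by (rule nn_integral_liminf) measurable
  also have "\<dots> \<le> ennreal ((2 * pi) ^ DIM('a)) * (\<integral>\<^sup>+x. ennreal ((norm (u x))\<^sup>2) \<partial>lborel)"
    using raw_fourier_gaussian_damped_bound[OF u, of "inverse (real (Suc _))"]
    by (intro order_trans[OF Liminf_mono[OF always_eventually] Liminf_const[THEN eq_refl]] allI) simp_all
  finally show ?thesis .
qed

section \<open>Transforms as limits in the mean\<close>

lemma L2_iff: "f \<in> L2 \<longleftrightarrow> f \<in> borel_measurable borel \<and> (\<integral>\<^sup>+x. ennreal ((norm (f x))\<^sup>2) \<partial>lborel) < \<infinity>"
  for f :: "'a::euclidean_space \<Rightarrow> complex"
  unfolding L2_def by (auto simp: integrable_iff_bounded)

lemma ennreal_L2_norm_power2: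
  fixes f :: "'a::euclidean_space \<Rightarrow> complex"
  assumes "f \<in> L2"
  shows "ennreal ((L2_norm f)\<^sup>2) = (\<integral>\<^sup>+x. ennreal ((norm (f x))\<^sup>2) \<partial>lborel)"
  using assms unfolding L2_def L2_norm_def by (simp add: nn_integral_eq_integral)

lemma L2_norm_nonneg: "0 \<le> L2_norm f"
  unfolding L2_norm_def by simp

lemma L2_norm_cong_AE:
  fixes f g :: "'a::euclidean_space \<Rightarrow> complex"
  assumes "f \<in> L2" "g \<in> L2" "AE x in lborel. f x = g x"
  shows "L2_norm f = L2_norm g"
proof -
  have [measurable]: "f \<in> borel_measurable borel" "g \<in> borel_measurable borel"
    using assms by (auto simp: L2_def)
  have "(\<integral>x. (norm (f x))\<^sup>2 \<partial>lborel) = (\<integral>x. (norm (g x))\<^sup>2 \<partial>lborel)"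
    using assms(3) by (intro integral_cong_AE) auto
  then show ?thesis by (simp add: L2_norm_def)
qed

lemma L2_cong_AE:
  fixes f g :: "'a::euclidean_space \<Rightarrow> complex"
  assumes "f \<in> L2" "g \<in> borel_measurable borel" "AE x in lborel. f x = g x"
  shows "g \<in> L2"
proof -
  have "(\<integral>\<^sup>+x. ennreal ((norm (g x))\<^sup>2) \<partial>lborel) = (\<integral>\<^sup>+x. ennreal ((norm (f x))\<^sup>2) \<partial>lborel)"
    using assms(3) by (intro nn_integral_cong_AE) auto
  with assms show ?thesis by (simp add: L2_iff)
qed

lemma nn_integral_lborel_uminus:
  fixes f :: "'a::euclidean_space \<Rightarrow> ennreal"
  assumes [measurable]: "f \<in> borel_measurable borel"
  shows "(\<integral>\<^sup>+x. f (- x) \<partial>lborel) = (\<integral>\<^sup>+x. f x \<partial>lborel)"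
proof -
  have "lborel = distr lborel borel (\<lambda>x::'a. - x)"
    using lborel_affine[of "-1" "0::'a"] by (simp add: density_1)
  then have "(\<integral>\<^sup>+x. f x \<partial>lborel) = (\<integral>\<^sup>+x. f x \<partial>distr lborel borel (\<lambda>x::'a. - x))"
    by simp
  then show ?thesis by (simp add: nn_integral_distr)
qed

text \<open>
  The common form of \<^const>\<open>fourier\<close> and \<^const>\<open>inv_fourier\<close>, so that each fact about limits in the
  mean is proved once for both. Only \<open>s = 1\<close> and \<open>s = -1\<close> occur.
\<close>

definition scaled_fourier :: "complex \<Rightarrow> real \<Rightarrow> ('a::euclidean_space \<Rightarrow> complex) \<Rightarrow> 'a \<Rightarrow> complex" where
  "scaled_fourier c s u \<xi> = c * raw_fourier u (s *\<^sub>R \<xi>)"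

lemma fourier_eq_scaled_fourier: "fourier = (scaled_fourier (complex_of_real (1 / (2 * pi) ^ DIM('a))) 1 :: ('a::euclidean_space \<Rightarrow> _) \<Rightarrow> _)"
  by (intro ext) (simp add: fourier_def scaled_fourier_def raw_fourier_def)

lemma inv_fourier_eq_scaled_fourier: "inv_fourier = scaled_fourier 1 (-1)"
  by (intro ext) (simp add: inv_fourier_def scaled_fourier_def raw_fourier_def inner_commute mult.commute)

lemma borel_measurable_scaled_fourier [measurable]:
  fixes u :: "'a::euclidean_space \<Rightarrow> complex"
  assumes [measurable]: "u \<in> borel_measurable borel"
  shows "scaled_fourier c s u \<in> borel_measurable borel"
  unfolding scaled_fourier_def by measurable

lemma scaled_fourier_L2_bound:
  fixes u :: "'a::euclidean_space \<Rightarrow> complex"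
  assumes u: "integrable lborel u" and s: "\<bar>s\<bar> = 1"
  shows "(\<integral>\<^sup>+\<xi>. ennreal ((norm (scaled_fourier c s u \<xi>))\<^sup>2) \<partial>lborel)
     \<le> ennreal ((norm c)\<^sup>2 * (2 * pi) ^ DIM('a)) * (\<integral>\<^sup>+x. ennreal ((norm (u x))\<^sup>2) \<partial>lborel)"
proof -
  have [measurable]: "u \<in> borel_measurable borel" using u by auto
  have "(\<integral>\<^sup>+\<xi>. ennreal ((norm (raw_fourier u (s *\<^sub>R \<xi>)))\<^sup>2) \<partial>lborel) = (\<integral>\<^sup>+\<xi>. ennreal ((norm (raw_fourier u \<xi>))\<^sup>2) \<partial>lborel)"
  proof (cases "s = 1")
    case False
    with s have [simp]: "s = -1" by linarith
    show ?thesis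
      using nn_integral_lborel_uminus[of "\<lambda>\<xi>. ennreal ((norm (raw_fourier u \<xi>))\<^sup>2)"] by simp
  qed simp
  also note raw_fourier_L2_bound[OF u]
  finally have "ennreal ((norm c)\<^sup>2) * (\<integral>\<^sup>+\<xi>. ennreal ((norm (raw_fourier u (s *\<^sub>R \<xi>)))\<^sup>2) \<partial>lborel)
    \<le> ennreal ((norm c)\<^sup>2) * (ennreal ((2 * pi) ^ DIM('a)) * (\<integral>\<^sup>+x. ennreal ((norm (u x))\<^sup>2) \<partial>lborel))"
    by (rule mult_left_mono) simp
  also have "ennreal ((norm c)\<^sup>2) * (\<integral>\<^sup>+\<xi>. ennreal ((norm (raw_fourier u (s *\<^sub>R \<xi>)))\<^sup>2) \<partial>lborel)
     = (\<integral>\<^sup>+\<xi>. ennreal ((norm (scaled_fourier c s u \<xi>))\<^sup>2) \<partial>lborel)"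
    by (simp add: scaled_fourier_def norm_mult power_mult_distrib ennreal_mult nn_integral_cmult)
  finally show ?thesis by (simp add: ennreal_mult mult.assoc)
qed

lemma scaled_fourier_in_L2:
  fixes u :: "'a::euclidean_space \<Rightarrow> complex"
  assumes u: "integrable lborel u" "u \<in> L2" and s: "\<bar>s\<bar> = 1"
  shows "scaled_fourier c s u \<in> L2"
proof -
  have "(\<integral>\<^sup>+\<xi>. ennreal ((norm (scaled_fourier c s u \<xi>))\<^sup>2) \<partial>lborel) < \<infinity>"
    using u(2) by (intro le_less_trans[OF scaled_fourier_L2_bound[OF u(1) s]]) (auto simp: L2_iff ennreal_mult_less_top)
  moreover have "scaled_fourier c s u \<in> borel_measurable borel" using u by (auto intro: borel_measurable_scaled_fourier)
  ultimately show ?thesis unfolding L2_iff by simp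
qed

lemma scaled_fourier_diff:
  fixes u :: "'a::euclidean_space \<Rightarrow> complex"
  assumes "integrable lborel u" "integrable lborel v"
  shows "scaled_fourier c s u \<xi> - scaled_fourier c s v \<xi> = scaled_fourier c s (\<lambda>x. u x - v x) \<xi>"
  unfolding scaled_fourier_def raw_fourier_def right_diff_distrib
  by (simp only: Bochner_Integration.integral_diff[OF integrable_iexp_mult[OF assms(1)] integrable_iexp_mult[OF assms(2)]]
       right_diff_distrib)

text \<open>
  On integrable functions in \<^const>\<open>L2\<close> the convergent integral is a limit in the mean: by
  linearity, its distance to the transform of a truncation is the transform of the cut-off tail, whose
  norm the Bessel inequality bounds by a multiple of that of the tail.
\<close>

lemma limit_in_mean_scaled_fourier:
  fixes u :: "'a::euclidean_space \<Rightarrow> complex"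
  assumes u: "integrable lborel u" "u \<in> L2" and s: "\<bar>s\<bar> = 1"
  shows "limit_in_mean (scaled_fourier c s) u (scaled_fourier c s u)"
  unfolding limit_in_mean_def
proof
  show "scaled_fourier c s u \<in> L2" using assms by (rule scaled_fourier_in_L2)
  have [measurable]: "u \<in> borel_measurable borel" using u by auto
  let ?cut = "\<lambda>R x. indicator (ball 0 R) x * u x"
  have [measurable]: "?cut R \<in> borel_measurable borel" for R :: real
    by (intro borel_measurable_times borel_measurable_indicator) auto
  let ?tail = "\<lambda>R x. ?cut R x - u x"
  let ?C = "ennreal ((norm c)\<^sup>2 * (2 * pi) ^ DIM('a))"
  have cut: "integrable lborel (?cut R)" for R
    by (rule Bochner_Integration.integrable_bound[OF u(1)]) (auto simp: norm_mult indicator_def)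
  have u2: "integrable lborel (\<lambda>x. (norm (u x))\<^sup>2)" using u(2) by (simp add: L2_def)
  have tail2: "norm ((norm (?tail R x))\<^sup>2) \<le> (norm (u x))\<^sup>2" for R x
    by (auto simp: indicator_def)
  have "((\<lambda>R. \<integral>x. (norm (?tail R x))\<^sup>2 \<partial>lborel) \<longlongrightarrow> (integral\<^sup>L (lborel :: 'a measure) (\<lambda>_. 0))) at_top"
  proof (rule integral_dominated_convergence_at_top[where w = "\<lambda>x. (norm (u x))\<^sup>2" and f = "\<lambda>_. 0"
          and s = "\<lambda>R x. (norm (?tail R x))\<^sup>2"])
    have "\<forall>\<^sub>F R in at_top. (norm (?tail R x))\<^sup>2 = 0" for x
      using eventually_gt_at_top[of "norm x"] by eventually_elim simp
    then show "AE x in lborel. ((\<lambda>R. (norm (?tail R x))\<^sup>2) \<longlongrightarrow> 0) at_top"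
      by (intro AE_I2 tendsto_eventually)
    show "\<forall>\<^sub>F R in at_top. AE x in lborel. norm ((norm (?tail R x))\<^sup>2) \<le> (norm (u x))\<^sup>2"
      by (intro always_eventually allI AE_I2 tail2)
  qed (use u2 in auto)
  then have "((\<lambda>R. ?C * ennreal (\<integral>x. (norm (?tail R x))\<^sup>2 \<partial>lborel)) \<longlongrightarrow> ?C * ennreal (integral\<^sup>L (lborel :: 'a measure) (\<lambda>_. 0))) at_top"
    by (intro ennreal_tendsto_cmult tendsto_ennrealI) auto
  then have lim: "((\<lambda>R. ?C * ennreal (\<integral>x. (norm (?tail R x))\<^sup>2 \<partial>lborel)) \<longlongrightarrow> 0) at_top"
    by simp
  show "((\<lambda>R. \<integral>\<^sup>+\<xi>. ennreal ((norm (scaled_fourier c s (?cut R) \<xi> - scaled_fourier c s u \<xi>))\<^sup>2) \<partial>lborel) \<longlongrightarrow> 0) at_top"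
  proof (rule tendsto_sandwich[OF _ _ tendsto_const lim])
    show "\<forall>\<^sub>F R in at_top. (\<integral>\<^sup>+\<xi>. ennreal ((norm (scaled_fourier c s (?cut R) \<xi> - scaled_fourier c s u \<xi>))\<^sup>2) \<partial>lborel)
         \<le> ?C * ennreal (\<integral>x. (norm (?tail R x))\<^sup>2 \<partial>lborel)"
    proof (rule always_eventually, rule allI)
      fix R :: real
      have t2: "integrable lborel (\<lambda>x. (norm (?tail R x))\<^sup>2)"
        by (rule Bochner_Integration.integrable_bound[OF u2]) (use tail2[of R] in auto)
      have "(\<integral>\<^sup>+\<xi>. ennreal ((norm (scaled_fourier c s (?cut R) \<xi> - scaled_fourier c s u \<xi>))\<^sup>2) \<partial>lborel)
          \<le> ?C * (\<integral>\<^sup>+x. ennreal ((norm (?tail R x))\<^sup>2) \<partial>lborel)"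
        unfolding scaled_fourier_diff[OF cut u(1)] by (rule scaled_fourier_L2_bound) (use cut u s in auto)
      also have "(\<integral>\<^sup>+x. ennreal ((norm (?tail R x))\<^sup>2) \<partial>lborel) = ennreal (\<integral>x. (norm (?tail R x))\<^sup>2 \<partial>lborel)"
        using t2 by (intro nn_integral_eq_integral) auto
      finally show "(\<integral>\<^sup>+\<xi>. ennreal ((norm (scaled_fourier c s (?cut R) \<xi> - scaled_fourier c s u \<xi>))\<^sup>2) \<partial>lborel)
         \<le> ?C * ennreal (\<integral>x. (norm (?tail R x))\<^sup>2 \<partial>lborel)" .
    qed
  qed simp
qed

lemma limit_in_mean_unique:
  fixes u g h :: "'a::euclidean_space \<Rightarrow> complex"
  assumes g: "limit_in_mean T u g" and h: "limit_in_mean T u h"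
    and [measurable]: "\<And>R. T (\<lambda>x. indicator (ball 0 R) x * u x) \<in> borel_measurable borel"
  shows "AE x in lborel. g x = h x"
proof -
  have [measurable]: "g \<in> borel_measurable borel" "h \<in> borel_measurable borel"
    using g h by (auto simp: limit_in_mean_def L2_def)
  let ?D = "\<lambda>g (R::real). \<integral>\<^sup>+\<xi>. ennreal ((norm (T (\<lambda>x. indicator (ball 0 R) x * u x) \<xi> - g \<xi>))\<^sup>2) \<partial>lborel"
  have "((\<lambda>R. 2 * ?D g R + 2 * ?D h R) \<longlongrightarrow> 2 * 0 + 2 * 0) at_top"
    using g h unfolding limit_in_mean_def
    by (intro tendsto_add ennreal_tendsto_cmult) auto
  moreover have "(\<integral>\<^sup>+\<xi>. ennreal ((norm (g \<xi> - h \<xi>))\<^sup>2) \<partial>lborel) \<le> 2 * ?D g R + 2 * ?D h R" for R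
  proof -
    let ?t = "T (\<lambda>x. indicator (ball 0 R) x * u x)"
    have "(norm (g \<xi> - h \<xi>))\<^sup>2 \<le> 2 * (norm (?t \<xi> - g \<xi>))\<^sup>2 + 2 * (norm (?t \<xi> - h \<xi>))\<^sup>2" for \<xi>
    proof -
      have "norm (g \<xi> - h \<xi>) \<le> norm (?t \<xi> - g \<xi>) + norm (?t \<xi> - h \<xi>)"
        using norm_triangle_ineq4[of "?t \<xi> - h \<xi>" "?t \<xi> - g \<xi>"] by (simp add: norm_minus_commute)
      then have "(norm (g \<xi> - h \<xi>))\<^sup>2 \<le> (norm (?t \<xi> - g \<xi>) + norm (?t \<xi> - h \<xi>))\<^sup>2"
        by (simp add: power_mono)
      also have "\<dots> \<le> 2 * (norm (?t \<xi> - g \<xi>))\<^sup>2 + 2 * (norm (?t \<xi> - h \<xi>))\<^sup>2"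
        using sum_squares_bound[of "norm (?t \<xi> - g \<xi>)" "norm (?t \<xi> - h \<xi>)"]
        by (simp add: power2_sum)
      finally show ?thesis .
    qed
    then have "(\<integral>\<^sup>+\<xi>. ennreal ((norm (g \<xi> - h \<xi>))\<^sup>2) \<partial>lborel)
       \<le> (\<integral>\<^sup>+\<xi>. 2 * ennreal ((norm (?t \<xi> - g \<xi>))\<^sup>2) + 2 * ennreal ((norm (?t \<xi> - h \<xi>))\<^sup>2) \<partial>lborel)"
      by (intro nn_integral_mono)
         (simp add: ennreal_leI ennreal_numeral[symmetric] ennreal_mult[symmetric] ennreal_plus[symmetric]
            del: ennreal_plus ennreal_numeral)
    also have "\<dots> = 2 * ?D g R + 2 * ?D h R"
      by (simp add: nn_integral_add nn_integral_cmult)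
    finally show ?thesis .
  qed
  ultimately have "(\<integral>\<^sup>+\<xi>. ennreal ((norm (g \<xi> - h \<xi>))\<^sup>2) \<partial>lborel) \<le> 2 * 0 + 2 * 0"
    by (intro tendsto_lowerbound[OF _ always_eventually]) auto
  then have "AE \<xi> in lborel. ennreal ((norm (g \<xi> - h \<xi>))\<^sup>2) = 0"
    by (subst nn_integral_0_iff_AE[symmetric]) auto
  then show ?thesis by eventually_elim simp
qed

text \<open>
  Existence and uniqueness together identify, up to a null set, the representative that \<open>SOME\<close>
  picks.
\<close>

lemma some_limit_in_mean_scaled_fourier:
  fixes u :: "'a::euclidean_space \<Rightarrow> complex"
  assumes u: "integrable lborel u" "u \<in> L2" and s: "\<bar>s\<bar> = 1"
  shows "(SOME g. limit_in_mean (scaled_fourier c s) u g) \<in> L2"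
    and "AE \<xi> in lborel. (SOME g. limit_in_mean (scaled_fourier c s) u g) \<xi> = scaled_fourier c s u \<xi>"
proof -
  have "u \<in> borel_measurable borel" using u by auto
  then have cut: "(\<lambda>x. indicator (ball 0 R) x * u x) \<in> borel_measurable borel" for R :: real
    by (intro borel_measurable_times borel_measurable_indicator) auto
  have ex: "limit_in_mean (scaled_fourier c s) u (scaled_fourier c s u)" using assms by (rule limit_in_mean_scaled_fourier)
  then have *: "limit_in_mean (scaled_fourier c s) u (SOME g. limit_in_mean (scaled_fourier c s) u g)" by (rule someI[of "limit_in_mean (scaled_fourier c s) u"])
  then show "(SOME g. limit_in_mean (scaled_fourier c s) u g) \<in> L2" by (simp add: limit_in_mean_def)
  show "AE \<xi> in lborel. (SOME g. limit_in_mean (scaled_fourier c s) u g) \<xi> = scaled_fourier c s u \<xi>"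
    by (rule limit_in_mean_unique[OF * ex borel_measurable_scaled_fourier[OF cut]])
qed

text \<open>
  The argument of the outer transform contains an unspecified representative of the inner one. It
  agrees almost everywhere with the weighted \<^const>\<open>fourier\<close> integral, hence inherits integrability
  and square integrability from it, and the identification of limits in the mean applies a second
  time.
\<close>

lemma H_space_criterion:
  fixes u :: "'a::euclidean_space \<Rightarrow> complex"
  assumes u: "integrable lborel u" "u \<in> L2"
    and w: "integrable lborel (\<lambda>\<xi>. bracket_weight m \<xi> * fourier u \<xi>)"
           "(\<lambda>\<xi>. bracket_weight m \<xi> * fourier u \<xi>) \<in> L2" (is "?w \<in> L2")
  shows "u \<in> H_space m"
    and "H_norm m u \<le> sqrt ((2 * pi) ^ DIM('a)) * L2_norm (\<lambda>\<xi>. bracket_weight m \<xi> * fourier u \<xi>)"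
proof -
  define f where "f \<xi> = bracket_weight m \<xi> * fourier_L2 u \<xi>" for \<xi>
  have F: "fourier_L2 u \<in> L2" "AE \<xi> in lborel. fourier_L2 u \<xi> = fourier u \<xi>"
    unfolding fourier_L2_def fourier_eq_scaled_fourier using some_limit_in_mean_scaled_fourier[OF u] by auto
  have [measurable]: "fourier_L2 u \<in> borel_measurable borel" using F by (simp add: L2_def)
  have [measurable]: "bracket_weight m \<in> borel_measurable (borel :: 'a measure)"
    unfolding bracket_weight_def by measurable
  have [measurable]: "f \<in> borel_measurable borel" unfolding f_def by measurable
  have AE: "AE \<xi> in lborel. ?w \<xi> = f \<xi>" using F(2) by eventually_elim (simp add: f_def)
  have f_int: "integrable lborel f"
    using w(1) _ AE by (rule integrable_cong_AE_imp) measurable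
  have f_L2: "f \<in> L2" using w(2) _ AE by (rule L2_cong_AE) measurable
  have I: "inv_fourier_L2 f \<in> L2" "AE x in lborel. inv_fourier_L2 f x = inv_fourier f x"
    unfolding inv_fourier_L2_def inv_fourier_eq_scaled_fourier using some_limit_in_mean_scaled_fourier[OF f_int f_L2] by auto
  show "u \<in> H_space m"
    using u(2) f_L2 I(1) unfolding H_space_def f_def by simp
  have inv_L2: "inv_fourier f \<in> L2"
    unfolding inv_fourier_eq_scaled_fourier by (rule scaled_fourier_in_L2[OF f_int f_L2]) simp
  have "H_norm m u = L2_norm (inv_fourier f)"
    unfolding H_norm_def f_def[symmetric] using I inv_L2 by (intro L2_norm_cong_AE) auto
  also have "\<dots> \<le> sqrt ((2 * pi) ^ DIM('a)) * L2_norm f"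
  proof (rule power2_le_imp_le)
    have "ennreal ((L2_norm (inv_fourier f))\<^sup>2) \<le> ennreal ((2 * pi) ^ DIM('a)) * ennreal ((L2_norm f)\<^sup>2)"
      unfolding ennreal_L2_norm_power2[OF inv_L2] ennreal_L2_norm_power2[OF f_L2]
      unfolding inv_fourier_eq_scaled_fourier
      using scaled_fourier_L2_bound[OF f_int, of "-1" 1] by simp
    then show "(L2_norm (inv_fourier f))\<^sup>2 \<le> (sqrt ((2 * pi) ^ DIM('a)) * L2_norm f)\<^sup>2"
      by (simp add: ennreal_mult[symmetric] power_mult_distrib)
  qed (simp add: L2_norm_nonneg)
  also have "L2_norm f = L2_norm ?w" using f_L2 w(2) AE by (intro L2_norm_cong_AE[symmetric])
  finally show "H_norm m u \<le> sqrt ((2 * pi) ^ DIM('a)) * L2_norm ?w" .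
qed

section \<open>The potential and its Fourier transform\<close>

text \<open>
  With \<open>a = 1\<close> this is the profile of the Fourier transform of the potential: the cosine moves half
  of the Gaussian to \<open>k\<close> and half to \<open>-k\<close>. The wider profile with \<open>a = 1/2\<close>, times
  a multiple of \<open>|k|\<^sup>m\<close>, dominates its product with a Sobolev weight of order \<open>m\<close>.
\<close>

definition two_bumps :: "real \<Rightarrow> 'a::euclidean_space \<Rightarrow> 'a \<Rightarrow> real" where
  "two_bumps a k \<xi> = (exp (- a * (norm (\<xi> + k))\<^sup>2 / 2) + exp (- a * (norm (\<xi> - k))\<^sup>2 / 2)) / 2"

lemma two_bumps_pos: "0 < two_bumps a k \<xi>"
  by (simp add: two_bumps_def add_pos_pos)

lemma two_bumps_le_1: "a \<ge> 0 \<Longrightarrow> two_bumps a k \<xi> \<le> 1"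
proof -
  assume a: "a \<ge> 0"
  then have *: "exp (- a * x\<^sup>2 / 2) \<le> 1" for x :: real
    by simp
  have "(p + q) / 2 \<le> 1" if "p \<le> 1" "q \<le> 1" for p q :: real
    using that by simp
  from this[OF * *] show ?thesis
    unfolding two_bumps_def .
qed

lemma continuous_on_two_bumps: "continuous_on S (two_bumps a k)"
  unfolding two_bumps_def by (intro continuous_intros) auto

lemma two_bumps_measurable [measurable]: "two_bumps a k \<in> borel_measurable borel"
  by (intro borel_measurable_continuous_onI continuous_on_two_bumps)

text \<open>
  By convexity of the square; this reduces \<^const>\<open>L2\<close> norms to the integral of another such
  function.
\<close>

lemma two_bumps_square_le: "(two_bumps a k \<xi>)\<^sup>2 \<le> two_bumps (2 * a) k \<xi>"
proof -
  define p where "p = exp (- a * (norm (\<xi> + k))\<^sup>2 / 2)"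
  define q where "q = exp (- a * (norm (\<xi> - k))\<^sup>2 / 2)"
  have "two_bumps (2 * a) k \<xi> = (p\<^sup>2 + q\<^sup>2) / 2"
    by (simp add: two_bumps_def p_def q_def exp_double[symmetric])
  moreover have "((p + q) / 2)\<^sup>2 \<le> (p\<^sup>2 + q\<^sup>2) / 2"
    using zero_le_power2[of "p - q"] by (simp add: power2_eq_square field_simps)
  ultimately show ?thesis by (simp add: two_bumps_def p_def q_def)
qed

lemma nn_integral_two_bumps:
  fixes k :: "'a::euclidean_space"
  assumes "a > 0"
  shows "(\<integral>\<^sup>+\<xi>. ennreal (two_bumps a k \<xi>) \<partial>lborel) = ennreal (sqrt (2 * pi / a) ^ DIM('a))"
proof -
  have "(\<integral>\<^sup>+\<xi>. ennreal (two_bumps a k \<xi>) \<partial>lborel)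
     = (\<integral>\<^sup>+\<xi>. ennreal (1/2) * ennreal (exp (- a * (norm (- k - \<xi>))\<^sup>2 / 2))
             + ennreal (1/2) * ennreal (exp (- a * (norm (k - \<xi>))\<^sup>2 / 2)) \<partial>lborel)"
  proof (rule nn_integral_cong)
    fix \<xi> :: 'a
    have "norm (- k - \<xi>) = norm (\<xi> + k)" "norm (k - \<xi>) = norm (\<xi> - k)"
      using norm_minus_cancel[of "\<xi> + k"] by (simp_all add: norm_minus_commute add.commute)
    then have eq: "two_bumps a k \<xi> = 1/2 * exp (- a * (norm (- k - \<xi>))\<^sup>2 / 2)
             + 1/2 * exp (- a * (norm (k - \<xi>))\<^sup>2 / 2)"
      by (simp add: two_bumps_def add_divide_distrib)
    show "ennreal (two_bumps a k \<xi>) = ennreal (1/2) * ennreal (exp (- a * (norm (- k - \<xi>))\<^sup>2 / 2))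
             + ennreal (1/2) * ennreal (exp (- a * (norm (k - \<xi>))\<^sup>2 / 2))"
      unfolding eq by (subst ennreal_plus, simp, simp, (subst ennreal_mult, simp, simp)+, rule refl)
  qed
  also have "\<dots> = ennreal (1/2) * ennreal (sqrt (2 * pi / a) ^ DIM('a)) + ennreal (1/2) * ennreal (sqrt (2 * pi / a) ^ DIM('a))"
    by (simp add: nn_integral_add nn_integral_cmult nn_integral_gaussian_translate[OF assms, simplified])
  also have "\<dots> = (ennreal (1/2) + ennreal (1/2)) * ennreal (sqrt (2 * pi / a) ^ DIM('a))"
    by (simp only: distrib_right)
  also have "ennreal (1/2) + ennreal (1/2) = 1"
    by (subst ennreal_plus[symmetric]) simp_all
  finally show ?thesis by simp
qed

lemma vpot_measurable [measurable]: "vpot k m \<epsilon> \<in> borel_measurable borel"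
  unfolding vpot_def by measurable

lemma norm_vpot_le:
  assumes "\<epsilon> \<ge> 0"
  shows "norm (vpot k m \<epsilon> x) \<le> \<epsilon> * norm k powi (- int m) * exp (- (norm x)\<^sup>2 / 2)"
proof -
  have "\<bar>cos (k \<bullet> x)\<bar> \<le> 1" by simp
  then have "\<epsilon> * norm k powi (- int m) * exp (- (norm x)\<^sup>2 / 2) * \<bar>cos (k \<bullet> x)\<bar>
      \<le> \<epsilon> * norm k powi (- int m) * exp (- (norm x)\<^sup>2 / 2) * 1"
    using assms by (intro mult_left_mono) auto
  moreover have "norm (vpot k m \<epsilon> x) = \<epsilon> * norm k powi (- int m) * exp (- (norm x)\<^sup>2 / 2) * \<bar>cos (k \<bullet> x)\<bar>"
    using assms unfolding vpot_def norm_of_real by (simp add: abs_mult)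
  ultimately show ?thesis by simp
qed

lemma integrable_vpot:
  fixes k :: "'a::euclidean_space"
  assumes "\<epsilon> \<ge> 0"
  shows "integrable lborel (vpot k m \<epsilon>)"
proof (rule Bochner_Integration.integrable_bound)
  show "integrable lborel (\<lambda>x::'a. \<epsilon> * norm k powi (- int m) * exp (- 1 * (norm x)\<^sup>2 / 2))"
    using gaussian_integral[of 1, where 'a='a] by (intro integrable_mult_right) (simp add: has_bochner_integral_iff)
  show "AE x in lborel. norm (vpot k m \<epsilon> x) \<le> norm (\<epsilon> * norm k powi (- int m) * exp (- 1 * (norm x)\<^sup>2 / 2))"
    using norm_vpot_le[OF assms, of k m] assms by (intro AE_I2) (simp add: abs_mult)
qed measurable

lemma fourier_vpot:
  fixes k :: "'a::euclidean_space"
  shows "fourier (vpot k m \<epsilon>) \<xi>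
    = complex_of_real ((1 / sqrt (2 * pi)) ^ DIM('a) * (\<epsilon> * norm k powi (- int m)) * two_bumps 1 k \<xi>)"
proof -
  define A where "A = \<epsilon> * norm k powi (- int m)"
  let ?e = "\<lambda>x. complex_of_real (exp (- 1 * (norm x)\<^sup>2 / 2))"
  have g: "has_bochner_integral lborel (\<lambda>x. iexp (\<eta> \<bullet> x) * ?e x)
           (complex_of_real (sqrt (2 * pi) ^ DIM('a) * exp (- (norm \<eta>)\<^sup>2 / 2)))" for \<eta> :: 'a
    using gaussian_iexp[of 1 \<eta>] by simp
  have eq: "complex_of_real (A / 2) * (iexp ((\<xi> + k) \<bullet> x) * ?e x + iexp ((\<xi> - k) \<bullet> x) * ?e x)
      = iexp (\<xi> \<bullet> x) * vpot k m \<epsilon> x" for x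
  proof -
    have 1: "complex_of_real (cos (k \<bullet> x)) = (iexp (k \<bullet> x) + exp (- (\<i> * complex_of_real (k \<bullet> x)))) / 2"
      by (simp add: cos_of_real[symmetric] cos_exp_eq)
    have 2: "iexp ((\<xi> + k) \<bullet> x) = iexp (\<xi> \<bullet> x) * iexp (k \<bullet> x)"
      by (simp add: inner_add_left distrib_left exp_add)
    have 3: "iexp ((\<xi> - k) \<bullet> x) = iexp (\<xi> \<bullet> x) * exp (- (\<i> * complex_of_real (k \<bullet> x)))"
      by (simp add: inner_diff_left right_diff_distrib exp_diff exp_minus divide_inverse)
    have 4: "vpot k m \<epsilon> x = complex_of_real A * ?e x * complex_of_real (cos (k \<bullet> x))"
      unfolding vpot_def A_def by simp
    show ?thesis unfolding 4 1 2 3 by (simp add: field_simps)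
  qed
  have "has_bochner_integral lborel (\<lambda>x. iexp (\<xi> \<bullet> x) * vpot k m \<epsilon> x)
     (complex_of_real (A / 2) * (complex_of_real (sqrt (2 * pi) ^ DIM('a) * exp (- (norm (\<xi> + k))\<^sup>2 / 2))
       + complex_of_real (sqrt (2 * pi) ^ DIM('a) * exp (- (norm (\<xi> - k))\<^sup>2 / 2))))"
    using has_bochner_integral_mult_right[OF has_bochner_integral_add[OF g[of "\<xi> + k"] g[of "\<xi> - k"]], of "complex_of_real (A / 2)"]
    unfolding eq by simp
  then have "fourier (vpot k m \<epsilon>) \<xi> = complex_of_real (1 / (2 * pi) ^ DIM('a)) *
     (complex_of_real (A / 2) * (complex_of_real (sqrt (2 * pi) ^ DIM('a) * exp (- (norm (\<xi> + k))\<^sup>2 / 2))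
       + complex_of_real (sqrt (2 * pi) ^ DIM('a) * exp (- (norm (\<xi> - k))\<^sup>2 / 2))))"
    unfolding fourier_def by (simp only: has_bochner_integral_iff)
  also have "\<dots> = complex_of_real (1 / (2 * pi) ^ DIM('a) * (A / 2 * (sqrt (2 * pi) ^ DIM('a) * exp (- (norm (\<xi> + k))\<^sup>2 / 2)
       + sqrt (2 * pi) ^ DIM('a) * exp (- (norm (\<xi> - k))\<^sup>2 / 2))))"
    by (simp only: of_real_mult of_real_add)
  also have "A / 2 * (sqrt (2 * pi) ^ DIM('a) * exp (- (norm (\<xi> + k))\<^sup>2 / 2)
       + sqrt (2 * pi) ^ DIM('a) * exp (- (norm (\<xi> - k))\<^sup>2 / 2)) = sqrt (2 * pi) ^ DIM('a) * (A * two_bumps 1 k \<xi>)"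
    by (simp add: two_bumps_def distrib_left add_divide_distrib mult_ac)
  also have "1 / (2 * pi) ^ DIM('a) * (sqrt (2 * pi) ^ DIM('a) * (A * two_bumps 1 k \<xi>))
     = (1 / (2 * pi) * sqrt (2 * pi)) ^ DIM('a) * (A * two_bumps 1 k \<xi>)"
    by (simp add: power_mult_distrib power_divide)
  also have "1 / (2 * pi) * sqrt (2 * pi) = 1 / sqrt (2 * pi)"
    using real_div_sqrt[of "2 * pi"] by (simp add: field_simps)
  finally show ?thesis by (simp add: A_def mult.assoc)
qed

text \<open>
  Writing \<open>cos\<^sup>2(kx) = (1 + cos(2kx)) / 2\<close> turns the squared norm into a Gaussian integral plus the real
  part of a Gaussian Fourier transform at \<open>2k\<close>. Both are positive, so oscillation costs at most half
  of the squared norm of the envelope.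
\<close>

lemma L2_vpot:
  fixes k :: "'a::euclidean_space"
  shows "vpot k m \<epsilon> \<in> L2"
    and "L2_norm (vpot k m \<epsilon>) = \<bar>\<epsilon>\<bar> * norm k powi (- int m) * sqrt (sqrt pi ^ DIM('a) * (1 + exp (- (norm k)\<^sup>2)) / 2)"
proof -
  define A where "A = \<epsilon> * norm k powi (- int m)"
  have g: "has_bochner_integral lborel (\<lambda>x. cos (\<eta> \<bullet> x) * exp (- (norm x)\<^sup>2)) (sqrt pi ^ DIM('a) * exp (- (norm \<eta>)\<^sup>2 / 4))"
    for \<eta> :: 'a
    using has_bochner_integral_Re[OF gaussian_iexp[of 2 \<eta>]] by (simp add: Re_exp del: of_real_mult of_real_power of_real_minus of_real_exp)
  have eq: "A\<^sup>2 / 2 * (cos (0 \<bullet> x) * exp (- (norm x)\<^sup>2) + cos ((2 *\<^sub>R k) \<bullet> x) * exp (- (norm x)\<^sup>2))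
      = (norm (vpot k m \<epsilon> x))\<^sup>2" for x
  proof -
    have "(exp (- (norm x)\<^sup>2 / 2))\<^sup>2 = exp (- (norm x)\<^sup>2)"
      by (simp add: exp_double[symmetric])
    then have "(norm (vpot k m \<epsilon> x))\<^sup>2 = A\<^sup>2 * exp (- (norm x)\<^sup>2) * (cos (k \<bullet> x))\<^sup>2"
      unfolding vpot_def norm_of_real power2_abs A_def[symmetric] by (simp add: power_mult_distrib)
    moreover have "cos ((2 *\<^sub>R k) \<bullet> x) = 2 * (cos (k \<bullet> x))\<^sup>2 - 1"
      by (simp add: cos_double_cos)
    ultimately show ?thesis
      by (simp only: inner_zero_left cos_zero) (simp add: algebra_simps)
  qed
  have hb: "has_bochner_integral lborel (\<lambda>x. (norm (vpot k m \<epsilon> x))\<^sup>2)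
      (A\<^sup>2 / 2 * (sqrt pi ^ DIM('a) + sqrt pi ^ DIM('a) * exp (- (norm k)\<^sup>2)))"
    using has_bochner_integral_mult_right[OF has_bochner_integral_add[OF g[of 0] g[of "2 *\<^sub>R k"]], of "A\<^sup>2 / 2"]
    unfolding eq by (simp add: power_mult_distrib)
  then show "vpot k m \<epsilon> \<in> L2" by (simp add: L2_def has_bochner_integral_iff)
  have "L2_norm (vpot k m \<epsilon>) = sqrt (A\<^sup>2 * (sqrt pi ^ DIM('a) * (1 + exp (- (norm k)\<^sup>2)) / 2))"
    using hb unfolding L2_norm_def by (simp add: has_bochner_integral_iff distrib_left)
  also have "\<dots> = \<bar>A\<bar> * sqrt (sqrt pi ^ DIM('a) * (1 + exp (- (norm k)\<^sup>2)) / 2)"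
    by (simp only: real_sqrt_mult real_sqrt_abs)
  finally show "L2_norm (vpot k m \<epsilon>) = \<bar>\<epsilon>\<bar> * norm k powi (- int m) * sqrt (sqrt pi ^ DIM('a) * (1 + exp (- (norm k)\<^sup>2)) / 2)"
    by (simp add: A_def abs_mult)
qed

text \<open>
  Completing the square gives \<open>t|x| \<le> \<sigma>t\<^sup>2 + x\<^sup>2/(4\<sigma>)\<close>. For \<open>\<sigma> > 1/2\<close> the last term is smaller than the
  \<open>x\<^sup>2/2\<close> of the Gaussian envelope, and a Gaussian of positive rate remains.
\<close>

lemma Q_vpot_le:
  fixes k :: "'a::euclidean_space"
  assumes \<sigma>: "\<sigma> > 1/2" and \<epsilon>: "\<epsilon> \<ge> 0"
  shows "Q (vpot k m \<epsilon>) t \<le> ennreal (\<epsilon> * norm k powi (- int m)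
      * (1 / (2 * pi) ^ DIM('a) * sqrt (2 * pi / (1 - 1 / (2 * \<sigma>))) ^ DIM('a)) * exp (\<sigma> * t\<^sup>2))"
proof -
  define A where "A = \<epsilon> * norm k powi (- int m)"
  define b where "b = 1 - 1 / (2 * \<sigma>)"
  have b: "b > 0" using \<sigma> by (simp add: b_def)
  have A0: "A \<ge> 0" using \<epsilon> by (simp add: A_def)
  have "Q (vpot k m \<epsilon>) t \<le> ennreal (1 / (2 * pi) ^ DIM('a)) *
     (\<integral>\<^sup>+x. ennreal (A * exp (\<sigma> * t\<^sup>2)) * ennreal (exp (- b * (norm (0 - x :: 'a))\<^sup>2 / 2)) \<partial>lborel)"
    unfolding Q_def
  proof (intro mult_left_mono nn_integral_mono)
    fix x :: 'a
    have "t * norm x \<le> \<sigma> * t\<^sup>2 + (norm x)\<^sup>2 / (4 * \<sigma>)"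
    proof -
      have "0 \<le> (2 * \<sigma> * t - norm x)\<^sup>2 / (4 * \<sigma>)" using \<sigma> by simp
      also have "\<dots> = \<sigma> * t\<^sup>2 + (norm x)\<^sup>2 / (4 * \<sigma>) - t * norm x"
        using \<sigma> by (simp add: power2_eq_square field_simps)
      finally show ?thesis by simp
    qed
    then have le: "t * norm x + - (norm x)\<^sup>2 / 2 \<le> \<sigma> * t\<^sup>2 + - b * (norm x)\<^sup>2 / 2"
      by (simp add: b_def field_simps)
    have "exp (t * norm x) * norm (vpot k m \<epsilon> x) \<le> exp (t * norm x) * (A * exp (- (norm x)\<^sup>2 / 2))"
      using norm_vpot_le[OF \<epsilon>, of k m x] by (simp add: A_def)
    also have "\<dots> = A * exp (t * norm x + - (norm x)\<^sup>2 / 2)" by (simp only: exp_add mult_ac)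
    also have "\<dots> \<le> A * exp (\<sigma> * t\<^sup>2 + - b * (norm x)\<^sup>2 / 2)"
      using le A0 by (intro mult_left_mono) simp_all
    also have "\<dots> = A * exp (\<sigma> * t\<^sup>2) * exp (- b * (norm (0 - x))\<^sup>2 / 2)"
      by (simp only: exp_add diff_0 norm_minus_cancel mult.assoc)
    finally show "ennreal (exp (t * norm x) * norm (vpot k m \<epsilon> x))
        \<le> ennreal (A * exp (\<sigma> * t\<^sup>2)) * ennreal (exp (- b * (norm (0 - x))\<^sup>2 / 2))"
      using A0 by (simp add: ennreal_mult[symmetric] ennreal_leI)
  qed simp
  also have "\<dots> = ennreal (1 / (2 * pi) ^ DIM('a)) * (ennreal (A * exp (\<sigma> * t\<^sup>2)) * ennreal (sqrt (2 * pi / b) ^ DIM('a)))"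
    by (subst nn_integral_cmult) (auto simp only: nn_integral_gaussian_translate[OF b], measurable)
  also have "\<dots> = ennreal (A * (1 / (2 * pi) ^ DIM('a) * sqrt (2 * pi / b) ^ DIM('a)) * exp (\<sigma> * t\<^sup>2))"
    using A0 b by (simp add: ennreal_mult[symmetric] mult_ac)
  finally show ?thesis unfolding A_def b_def .
qed

lemma powr_half_times_exp_le:
  fixes s :: real
  assumes s: "s \<ge> 0" and m: "m > 0"
  shows "(1 + s) powr (real m / 2) * exp (- s / 4) \<le> (4 * real m) ^ m * exp (1 / 4)"
proof -
  have "(1 + s) powr (real m / 2) \<le> (1 + s) powr real m"
    using s by (intro powr_mono) auto
  also have "\<dots> = (1 + s) ^ m" using s by (simp add: powr_realpow)
  \<comment> \<open>the scale \<open>4 * m\<close> makes the \<open>m\<close>-th power of \<open>exp\<close> equal to \<open>exp ((1 + s) / 4)\<close>\<close>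
  also have "\<dots> = (4 * real m) ^ m * ((1 + s) / (4 * real m)) ^ m"
    using m by (subst power_mult_distrib[symmetric]) simp
  also have "\<dots> \<le> (4 * real m) ^ m * (exp ((1 + s) / (4 * real m))) ^ m"
  proof (intro mult_left_mono power_mono)
    show "(1 + s) / (4 * real m) \<le> exp ((1 + s) / (4 * real m))"
      using exp_ge_add_one_self[of "(1 + s) / (4 * real m)"] by linarith
  qed (use s in auto)
  also have "(exp ((1 + s) / (4 * real m))) ^ m = exp (1 / 4) * exp (s / 4)"
    using m by (simp add: exp_of_nat_mult[symmetric] exp_add[symmetric] field_simps)
  finally have "(1 + s) powr (real m / 2) * exp (- s / 4) \<le> (4 * real m) ^ m * (exp (1 / 4) * exp (s / 4)) * exp (- s / 4)"
    by (intro mult_right_mono) auto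
  then show ?thesis by (simp add: mult.assoc exp_add[symmetric])
qed

text \<open>
  Peetre's inequality: moving a weight of order \<open>m\<close> from \<open>\<xi>\<close> to \<open>\<eta> = \<xi> \<plusminus> k\<close> costs a multiple of
  \<open>|k|\<^sup>m\<close>, and half of the Gaussian exponent absorbs the remaining weight at \<open>\<eta>\<close>.
\<close>

lemma weight_shift_le:
  fixes k \<xi> \<eta> :: "'a::euclidean_space"
  assumes k: "norm k \<ge> 1" and m: "m > 0" and \<xi>: "norm \<xi> \<le> norm \<eta> + norm k"
  shows "(1 + (norm \<xi>)\<^sup>2) powr (real m / 2) * exp (- 1 * (norm \<eta>)\<^sup>2 / 2)
     \<le> 2 ^ m * (4 * real m) ^ m * exp (1 / 4) * norm k ^ m * exp (- (1 / 2) * (norm \<eta>)\<^sup>2 / 2)"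
proof -
  let ?s = "(norm \<eta>)\<^sup>2"
  have "(norm \<xi>)\<^sup>2 \<le> (norm \<eta> + norm k)\<^sup>2" using \<xi> by (simp add: power_mono)
  also have "\<dots> \<le> 2 * ?s + 2 * (norm k)\<^sup>2"
    using sum_squares_bound[of "norm \<eta>" "norm k"] by (simp add: power2_sum)
  finally have "1 + (norm \<xi>)\<^sup>2 \<le> 1 + 2 * ?s + 2 * (norm k)\<^sup>2" by simp
  also have "\<dots> \<le> (2 * norm k)\<^sup>2 * (1 + ?s)"
  proof -
    have k2: "1 \<le> (norm k)\<^sup>2" using k by simp
    moreover have "1 * ?s \<le> (norm k)\<^sup>2 * ?s" using k2 by (rule mult_right_mono) simp
    moreover have "0 \<le> ?s" by simp
    ultimately have "1 + 2 * ?s + 2 * (norm k)\<^sup>2 \<le> 4 * (norm k)\<^sup>2 + 4 * ((norm k)\<^sup>2 * ?s)"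
      by linarith
    then show ?thesis by (simp add: power_mult_distrib distrib_left)
  qed
  finally have "(1 + (norm \<xi>)\<^sup>2) powr (real m / 2) \<le> ((2 * norm k)\<^sup>2 * (1 + ?s)) powr (real m / 2)"
    by (intro powr_mono2) (auto simp: add_nonneg_nonneg)
  also have "\<dots> = ((2 * norm k)\<^sup>2) powr (real m / 2) * (1 + ?s) powr (real m / 2)"
    by (rule powr_mult)
  also have "((2 * norm k)\<^sup>2) powr (real m / 2) = 2 ^ m * norm k ^ m"
  proof -
    have "((2 * norm k)\<^sup>2) powr (real m / 2) = (2 * norm k) powr real m"
    proof -
      have "(2 * norm k)\<^sup>2 = (2 * norm k) powr 2" using k by simp
      then show ?thesis by (simp only: powr_powr) simp
    qed
    also have "\<dots> = (2 * norm k) ^ m" using k by (intro powr_realpow) linarith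
    finally show ?thesis by (simp only: power_mult_distrib)
  qed
  finally have "(1 + (norm \<xi>)\<^sup>2) powr (real m / 2) * exp (- 1 * ?s / 2)
      \<le> 2 ^ m * norm k ^ m * (1 + ?s) powr (real m / 2) * exp (- 1 * ?s / 2)"
    by (intro mult_right_mono) auto
  also have "\<dots> = 2 ^ m * norm k ^ m * ((1 + ?s) powr (real m / 2) * exp (- ?s / 4)) * exp (- (1 / 2) * ?s / 2)"
    by (simp add: mult.assoc exp_add[symmetric])
  also have "\<dots> \<le> 2 ^ m * norm k ^ m * ((4 * real m) ^ m * exp (1 / 4)) * exp (- (1 / 2) * ?s / 2)"
    by (intro mult_right_mono mult_left_mono powr_half_times_exp_le m) auto
  finally show ?thesis by (simp add: mult_ac)
qed

lemma weight_two_bumps_le: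
  fixes k \<xi> :: "'a::euclidean_space"
  assumes k: "norm k \<ge> 1" and m: "m > 0"
  shows "(1 + (norm \<xi>)\<^sup>2) powr (real m / 2) * two_bumps 1 k \<xi>
     \<le> 2 ^ m * (4 * real m) ^ m * exp (1 / 4) * norm k ^ m * two_bumps (1 / 2) k \<xi>"
proof -
  have 1: "norm \<xi> \<le> norm (\<xi> + k) + norm k" using norm_triangle_ineq4[of "\<xi> + k" k] by simp
  have 2: "norm \<xi> \<le> norm (\<xi> - k) + norm k" using norm_triangle_ineq[of "\<xi> - k" k] by simp
  show ?thesis
    unfolding two_bumps_def using weight_shift_le[OF k m 1] weight_shift_le[OF k m 2]
    by (simp add: distrib_left add_divide_distrib)
qed

section \<open>Norms of the potential\<close>

lemma Linf_bounded:
  assumes S: "S \<in> sets borel" and f: "f \<in> borel_measurable borel"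
    and le: "\<And>x. x \<in> S \<Longrightarrow> norm (f x) \<le> c" and c: "c \<ge> 0"
  shows "f \<in> Linf S" and "Linf_norm S f \<le> c"
proof -
  have m: "f \<in> borel_measurable (restrict_space lborel S)"
    using f by (intro measurable_restrict_space1) simp
  have "AE x in restrict_space lborel S. ennreal (norm (f x)) \<le> ennreal c"
    using S le by (intro AE_I2) (auto simp: space_restrict_space intro!: ennreal_leI)
  then have *: "esssup (restrict_space lborel S) (\<lambda>x. ennreal (norm (f x))) \<le> ennreal c"
    using m by (intro esssup_I) auto
  have "esssup (restrict_space lborel S) (\<lambda>x. ennreal (norm (f x))) < \<infinity>"
    using * by (rule le_less_trans) simp
  then show "f \<in> Linf S" using m by (simp add: Linf_def)
  show "Linf_norm S f \<le> c"
    unfolding Linf_norm_def using enn2real_mono[OF *] c by simp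
qed

text \<open>
  On an open set, the norm of a continuous function cannot exceed its essential supremum even at one
  point, since it would then do so on a nonempty open set, which has positive measure.
\<close>

lemma norm_le_Linf_norm:
  fixes f :: "'a::euclidean_space \<Rightarrow> 'b::real_normed_vector"
  assumes f: "f \<in> Linf S" and S: "open S" and cont: "continuous_on UNIV f" and p: "p \<in> S"
  shows "norm (f p) \<le> Linf_norm S f"
proof -
  let ?L = "Linf_norm S f"
  let ?e = "esssup (restrict_space lborel S) (\<lambda>x. ennreal (norm (f x)))"
  have "?e < \<infinity>" using f by (simp add: Linf_def)
  then have e: "?e = ennreal ?L" by (simp add: Linf_norm_def)
  have "AE x in restrict_space lborel S. ennreal (norm (f x)) \<le> ?e" by (rule esssup_AE)
  then have "AE x in lborel. x \<in> S \<longrightarrow> ennreal (norm (f x)) \<le> ennreal ?L"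
    unfolding e using S by (subst (asm) AE_restrict_space_iff) auto
  then have "AE x in lborel. x \<in> S \<longrightarrow> x \<in> {x. norm (f x) \<le> ?L}"
    by eventually_elim (auto simp: Linf_norm_def)
  then have "AE x\<in>S in lebesgue. x \<in> {x. norm (f x) \<le> ?L}"
    by (rule AE_completion)
  moreover have "closed {x. norm (f x) \<le> ?L}"
    using cont by (intro closed_Collect_le continuous_intros)
  ultimately have "p \<in> {x. norm (f x) \<le> ?L}"
    using mem_closed_if_AE_lebesgue_open[OF S] p by blast
  then show ?thesis by simp
qed

lemma Linf_norm_vpot:
  fixes k :: "'a::euclidean_space"
  assumes \<epsilon>: "\<epsilon> \<ge> 0"
  shows "vpot k m \<epsilon> \<in> Linf UNIV" and "Linf_norm UNIV (vpot k m \<epsilon>) = \<epsilon> * norm k powi (- int m)"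
proof -
  let ?A = "\<epsilon> * norm k powi (- int m)"
  have "?A * exp (- (norm x)\<^sup>2 / 2) \<le> ?A" for x :: 'a
    using \<epsilon> by (intro mult_left_le) auto
  then have le: "norm (vpot k m \<epsilon> x) \<le> ?A" for x
    by (rule order_trans[OF norm_vpot_le[OF \<epsilon>]])
  have A: "?A \<ge> 0" using \<epsilon> by simp
  show L: "vpot k m \<epsilon> \<in> Linf UNIV"
    by (rule Linf_bounded[OF _ vpot_measurable le A]) auto
  have "Linf_norm UNIV (vpot k m \<epsilon>) \<le> ?A"
    by (rule Linf_bounded[OF _ vpot_measurable le A]) auto
  moreover have "norm (vpot k m \<epsilon> 0) \<le> Linf_norm UNIV (vpot k m \<epsilon>)"
    by (rule norm_le_Linf_norm[OF L]) (auto simp: vpot_def intro!: continuous_intros)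
  moreover have "norm (vpot k m \<epsilon> 0) = ?A"
    using A unfolding vpot_def norm_of_real by simp
  ultimately show "Linf_norm UNIV (vpot k m \<epsilon>) = ?A" by simp
qed

text \<open>
  The factor \<open>|k|\<^sup>m\<close> that the weight produces is cancelled by the amplitude \<open>|k|\<^sup>-\<^sup>m\<close> of the potential, so the bound
  is uniform in \<open>k\<close> but for the position of the bumps.
\<close>

lemma weighted_fourier_vpot_le:
  fixes k \<xi> :: "'a::euclidean_space"
  assumes k: "norm k > 1" and m: "m > 0" and \<epsilon>: "\<epsilon> \<ge> 0"
  shows "norm (bracket_weight m \<xi> * fourier (vpot k m \<epsilon>) \<xi>)
    \<le> \<epsilon> * ((1 / sqrt (2 * pi)) ^ DIM('a) * (2 ^ m * (4 * real m) ^ m * exp (1 / 4))) * two_bumps (1 / 2) k \<xi>"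
proof -
  define c where "c = (1 / sqrt (2 * pi)) ^ DIM('a)"
  define K where "K = 2 ^ m * (4 * real m) ^ m * exp (1 / 4)"
  define w where "w = (1 + (norm \<xi>)\<^sup>2) powr (real m / 2)"
  have c: "c \<ge> 0" by (simp add: c_def)
  have "norm (bracket_weight m \<xi> * fourier (vpot k m \<epsilon>) \<xi>) = w * (c * (\<epsilon> * norm k powi (- int m)) * two_bumps 1 k \<xi>)"
    unfolding bracket_weight_def fourier_vpot norm_mult norm_of_real w_def[symmetric] c_def[symmetric]
    using c \<epsilon> two_bumps_pos[of 1 k \<xi>] by (simp add: abs_mult w_def)
  also have "\<dots> = c * (\<epsilon> * norm k powi (- int m)) * (w * two_bumps 1 k \<xi>)" by (simp add: mult_ac)
  also have "\<dots> \<le> c * (\<epsilon> * norm k powi (- int m)) * (K * norm k ^ m * two_bumps (1 / 2) k \<xi>)"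
    unfolding w_def K_def using c \<epsilon> k by (intro mult_left_mono weight_two_bumps_le m) auto
  also have "\<dots> = \<epsilon> * (c * K) * two_bumps (1 / 2) k \<xi> * (norm k powi (- int m) * norm k ^ m)"
    by (simp add: mult_ac)
  also have "norm k powi (- int m) * norm k ^ m = 1"
  proof -
    have "norm k ^ m > 0" using k by (intro zero_less_power) linarith
    then show ?thesis
      unfolding power_int_minus power_int_of_nat by (intro left_inverse) linarith
  qed
  finally show ?thesis by (simp add: c_def K_def)
qed

text \<open>
  The dominating function in \<open>weighted_fourier_vpot_le\<close> is at most a constant multiple of \<open>\<epsilon>\<close>, which bounds the
  norm of \<^const>\<open>W_space\<close>, and by translation invariance of the integral its \<^const>\<open>L2\<close> norm is bounded
  uniformly in \<open>k\<close>, which bounds that of \<^const>\<open>H_space\<close>.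
\<close>

lemma vpot_sobolev_bounds:
  assumes m: "m > 0"
  shows "\<exists>C>0. \<forall>(k :: 'a::euclidean_space) \<epsilon>. norm k > 1 \<longrightarrow> \<epsilon> > 0 \<longrightarrow>
     vpot k m \<epsilon> \<in> W_space m \<and> W_norm m (vpot k m \<epsilon>) \<le> \<epsilon> * C \<and>
     vpot k m \<epsilon> \<in> H_space m \<and> H_norm m (vpot k m \<epsilon>) \<le> \<epsilon> * C"
proof -
  define D where "D = (1 / sqrt (2 * pi)) ^ DIM('a) * (2 ^ m * (4 * real m) ^ m * exp (1 / 4))"
  define S where "S = sqrt ((2 * pi) ^ DIM('a))"
  define G where "G = sqrt (sqrt (2 * pi) ^ DIM('a))"
  have D: "D > 0" using m by (simp add: D_def)
  have G: "G \<ge> 0" and S: "S \<ge> 0" by (simp_all add: G_def S_def)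
  have SG: "D * (S * G) \<ge> 0" using D S G by simp
  show ?thesis
  proof (intro exI[of _ "D + D * (S * G)"] conjI allI impI)
    show "D + D * (S * G) > 0" using D SG by linarith
  next
    fix k :: 'a and \<epsilon> :: real
    assume k: "norm k > 1" and \<epsilon>: "\<epsilon> > 0"
    let ?v = "vpot k m \<epsilon>" and ?w = "\<lambda>\<xi>. bracket_weight m \<xi> * fourier (vpot k m \<epsilon>) \<xi>"
    have int: "integrable lborel ?v" using \<epsilon> by (intro integrable_vpot) simp
    have le: "norm (?w \<xi>) \<le> \<epsilon> * D * two_bumps (1/2) k \<xi>" for \<xi>
      unfolding D_def using weighted_fourier_vpot_le[OF k m] \<epsilon> by simp
    have [measurable]: "?w \<in> borel_measurable borel"
      unfolding bracket_weight_def fourier_vpot by measurable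
    have \<epsilon>D: "\<epsilon> * D \<ge> 0" using \<epsilon> D by simp
    have "\<epsilon> * D * two_bumps (1/2) k \<xi> \<le> \<epsilon> * D" for \<xi>
      using \<epsilon>D by (intro mult_left_le two_bumps_le_1) auto
    then have le1: "norm (?w \<xi>) \<le> \<epsilon> * D" for \<xi>
      by (rule order_trans[OF le])
    have "?w \<in> Linf UNIV" and W: "Linf_norm UNIV ?w \<le> \<epsilon> * D"
      by (rule Linf_bounded; use le1 \<epsilon>D in simp)+
    then show "?v \<in> W_space m" using int by (simp add: W_space_def)
    show "W_norm m ?v \<le> \<epsilon> * (D + D * (S * G))"
      using W SG \<epsilon> unfolding W_norm_def distrib_left by (smt (verit) mult_nonneg_nonneg)
    have bumps_int: "integrable lborel (two_bumps a k)" if "a > 0" for a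
      using nn_integral_two_bumps[OF that, of k] two_bumps_pos[of a k]
      by (intro integrableI_nonneg) (auto intro: less_imp_le)
    have bumps_I: "(\<integral>\<xi>. two_bumps a k \<xi> \<partial>lborel) = sqrt (2 * pi / a) ^ DIM('a)" if "a > 0" for a
      using nn_integral_two_bumps[OF that, of k] two_bumps_pos[of a k] that
      by (subst integral_eq_nn_integral) (auto intro: less_imp_le)
    have w_int: "integrable lborel ?w"
    proof (rule Bochner_Integration.integrable_bound)
      show "integrable lborel (\<lambda>\<xi>. \<epsilon> * D * two_bumps (1/2) k \<xi>)"
        by (intro integrable_mult_right bumps_int) simp
      show "AE \<xi> in lborel. norm (?w \<xi>) \<le> norm (\<epsilon> * D * two_bumps (1/2) k \<xi>)"
        using le by (intro AE_I2) (simp add: order_trans[OF _ abs_ge_self])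
    qed measurable
    have le2: "(norm (?w \<xi>))\<^sup>2 \<le> (\<epsilon> * D)\<^sup>2 * two_bumps 1 k \<xi>" for \<xi>
    proof -
      have "(norm (?w \<xi>))\<^sup>2 \<le> (\<epsilon> * D * two_bumps (1/2) k \<xi>)\<^sup>2"
        using le by (intro power_mono) auto
      also have "\<dots> = (\<epsilon> * D)\<^sup>2 * (two_bumps (1/2) k \<xi>)\<^sup>2" by (rule power_mult_distrib)
      also have "\<dots> \<le> (\<epsilon> * D)\<^sup>2 * two_bumps 1 k \<xi>"
        using two_bumps_square_le[of "1/2" k \<xi>] by (intro mult_left_mono) auto
      finally show ?thesis .
    qed
    have bint: "integrable lborel (\<lambda>\<xi>. (\<epsilon> * D)\<^sup>2 * two_bumps 1 k \<xi>)"
      by (intro integrable_mult_right bumps_int) simp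
    have w2_int: "integrable lborel (\<lambda>\<xi>. (norm (?w \<xi>))\<^sup>2)"
      using le2 by (intro Bochner_Integration.integrable_bound[OF bint] AE_I2)
                   (measurable, simp add: order_trans[OF _ abs_ge_self])
    then have w_L2: "?w \<in> L2" by (simp add: L2_def)
    have "(\<integral>\<xi>. (norm (?w \<xi>))\<^sup>2 \<partial>lborel) \<le> (\<integral>\<xi>. (\<epsilon> * D)\<^sup>2 * two_bumps 1 k \<xi> \<partial>lborel)"
      using le2 by (intro integral_mono w2_int bint)
    also have "\<dots> = (\<epsilon> * D)\<^sup>2 * sqrt (2 * pi) ^ DIM('a)"
      by (simp add: bumps_I)
    finally have "L2_norm ?w \<le> sqrt ((\<epsilon> * D)\<^sup>2 * sqrt (2 * pi) ^ DIM('a))"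
      unfolding L2_norm_def by (rule real_sqrt_le_mono)
    also have "\<dots> = \<epsilon> * D * G"
      unfolding real_sqrt_mult real_sqrt_abs G_def using \<epsilon>D by simp
    finally have w_norm: "L2_norm ?w \<le> \<epsilon> * D * G" .
    show "?v \<in> H_space m"
      by (rule H_space_criterion[OF int L2_vpot(1) w_int w_L2])
    have "H_norm m ?v \<le> S * L2_norm ?w"
      unfolding S_def by (rule H_space_criterion[OF int L2_vpot(1) w_int w_L2])
    also have "\<dots> \<le> S * (\<epsilon> * D * G)" using w_norm S by (rule mult_left_mono)
    also have "\<dots> = \<epsilon> * (D * (S * G))" by (simp add: mult_ac)
    also have "\<dots> \<le> \<epsilon> * (D + D * (S * G))" using \<epsilon> D by simp
    finally show "H_norm m ?v \<le> \<epsilon> * (D + D * (S * G))" .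
  qed
qed

text \<open>
  Both bumps are at distance at least \<open>|k| - r\<close> from the ball of radius \<open>r\<close>. The cross term
  in \<open>(|k| - r)\<^sup>2 / 2\<close> is linear in \<open>|k|\<close>, so lowering the rate from \<open>1/2\<close> to \<open>\<alpha>\<close> leaves room for it;
  completing the square yields the constant.
\<close>

lemma two_bumps_le_far:
  fixes k \<xi> :: "'a::euclidean_space"
  assumes \<xi>: "norm \<xi> < r" and k: "norm k \<ge> r" and \<alpha>: "\<alpha> < 1/2"
  shows "two_bumps 1 k \<xi> \<le> exp (r\<^sup>2 / (2 * (1 - 2 * \<alpha>))) * exp (- \<alpha> * (norm k)\<^sup>2)"
proof -
  have *: "exp (- 1 * (norm \<eta>)\<^sup>2 / 2) \<le> exp (r\<^sup>2 / (2 * (1 - 2 * \<alpha>)) + - \<alpha> * (norm k)\<^sup>2)"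
    if "norm k - r \<le> norm \<eta>" for \<eta> :: 'a
  proof -
    define d where "d = 1 - 2 * \<alpha>"
    have d: "d > 0" using \<alpha> by (simp add: d_def)
    have "0 \<le> (d * norm k - r)\<^sup>2 / d" using d by simp
    also have "\<dots> = d * (norm k)\<^sup>2 - 2 * r * norm k + r\<^sup>2 / d"
      using d by (simp add: power2_eq_square field_simps)
    finally have "2 * \<alpha> * (norm k)\<^sup>2 - r\<^sup>2 / d \<le> (norm k)\<^sup>2 - 2 * r * norm k"
      unfolding d_def by (simp add: algebra_simps)
    also have "\<dots> \<le> (norm k)\<^sup>2 - 2 * r * norm k + r\<^sup>2" by simp
    also have "\<dots> = (norm k - r)\<^sup>2" by (simp add: power2_diff)
    also have "\<dots> \<le> (norm \<eta>)\<^sup>2" using that k by (intro power_mono) auto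
    finally have "2 * \<alpha> * (norm k)\<^sup>2 - r\<^sup>2 / d \<le> (norm \<eta>)\<^sup>2" .
    moreover have "r\<^sup>2 / (2 * d) = r\<^sup>2 / d / 2" by simp
    ultimately have "- 1 * (norm \<eta>)\<^sup>2 / 2 \<le> r\<^sup>2 / (2 * d) + - \<alpha> * (norm k)\<^sup>2" by linarith
    then show ?thesis unfolding d_def exp_le_cancel_iff .
  qed
  have "norm k \<le> norm (\<xi> + k) + norm \<xi>" using norm_triangle_ineq4[of "\<xi> + k" \<xi>] by simp
  moreover have "norm k \<le> norm (\<xi> - k) + norm \<xi>"
    using norm_triangle_ineq4[of \<xi> "\<xi> - k"] by simp
  ultimately have 1: "norm k - r \<le> norm (\<xi> + k)" and 2: "norm k - r \<le> norm (\<xi> - k)"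
    using \<xi> by linarith+
  have "(p + q) / 2 \<le> b" if "p \<le> b" "q \<le> b" for p q b :: real
    using that by simp
  from this[OF *[OF 1] *[OF 2]] show ?thesis unfolding two_bumps_def exp_add .
qed

text \<open>
  Positivity of the norm matters for the logarithmic estimates: there the inverse of the norm
  is taken, and the default value \<open>inverse 0 = 0\<close> would make the logarithm small instead of large.
\<close>

lemma fourier_vpot_Linf_ball:
  fixes k :: "'a::euclidean_space"
  assumes r: "r > 0" and \<epsilon>: "\<epsilon> > 0" and k: "k \<noteq> 0"
  shows "fourier (vpot k m \<epsilon>) \<in> Linf (ball 0 r)"
    and "Linf_norm (ball 0 r) (fourier (vpot k m \<epsilon>)) > 0"
    and "\<lbrakk>norm k \<ge> r; norm k \<ge> 1; \<alpha> < 1/2\<rbrakk> \<Longrightarrow> Linf_norm (ball 0 r) (fourier (vpot k m \<epsilon>))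
      \<le> (1 / sqrt (2 * pi)) ^ DIM('a) * \<epsilon> * exp (r\<^sup>2 / (2 * (1 - 2 * \<alpha>))) * exp (- \<alpha> * (norm k)\<^sup>2)"
proof -
  define c where "c = (1 / sqrt (2 * pi)) ^ DIM('a) * (\<epsilon> * norm k powi (- int m))"
  have c: "c > 0" using \<epsilon> k by (simp add: c_def)
  have F: "fourier (vpot k m \<epsilon>) = (\<lambda>\<xi>. complex_of_real (c * two_bumps 1 k \<xi>))"
    by (intro ext) (simp only: fourier_vpot c_def)
  have norm_F: "norm (fourier (vpot k m \<epsilon>) \<xi>) = c * two_bumps 1 k \<xi>" for \<xi>
    using c two_bumps_pos[of 1 k \<xi>] unfolding F norm_of_real by simp
  have cont: "continuous_on UNIV (fourier (vpot k m \<epsilon>))"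
    unfolding F by (intro continuous_intros continuous_on_two_bumps)
  have meas: "fourier (vpot k m \<epsilon>) \<in> borel_measurable borel"
    using cont by (rule borel_measurable_continuous_onI)
  have "c * two_bumps 1 k \<xi> \<le> c * 1" for \<xi>
    using c by (intro mult_left_mono two_bumps_le_1) auto
  then show L: "fourier (vpot k m \<epsilon>) \<in> Linf (ball 0 r)"
    using c by (intro Linf_bounded(1)[OF _ meas, of _ c]) (simp_all add: norm_F)
  have "0 < c * two_bumps 1 k 0" using c two_bumps_pos[of 1 k 0] by simp
  also have "\<dots> \<le> Linf_norm (ball 0 r) (fourier (vpot k m \<epsilon>))"
    unfolding norm_F[symmetric] by (rule norm_le_Linf_norm[OF L _ cont]) (use r in auto)
  finally show "Linf_norm (ball 0 r) (fourier (vpot k m \<epsilon>)) > 0" .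
  assume kr: "norm k \<ge> r" and k1: "norm k \<ge> 1" and \<alpha>: "\<alpha> < 1/2"
  let ?B = "exp (r\<^sup>2 / (2 * (1 - 2 * \<alpha>))) * exp (- \<alpha> * (norm k)\<^sup>2)"
  have c_le: "c \<le> (1 / sqrt (2 * pi)) ^ DIM('a) * \<epsilon>"
  proof -
    have "norm k powi (- int m) \<le> 1"
      using one_le_power[OF k1, of m] by (simp add: power_int_minus inverse_le_1_iff)
    then have "\<epsilon> * norm k powi (- int m) \<le> \<epsilon> * 1" using \<epsilon> by (intro mult_left_mono) auto
    then show ?thesis unfolding c_def by (intro mult_left_mono) auto
  qed
  have "norm (fourier (vpot k m \<epsilon>) \<xi>) \<le> (1 / sqrt (2 * pi)) ^ DIM('a) * \<epsilon> * ?B" if "\<xi> \<in> ball 0 r" for \<xi>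
    unfolding norm_F using c_le c two_bumps_le_far[OF _ kr \<alpha>, of \<xi>] that two_bumps_pos[of 1 k \<xi>] \<epsilon>
    by (intro mult_mono) (auto intro: less_imp_le)
  then have "Linf_norm (ball 0 r) (fourier (vpot k m \<epsilon>)) \<le> (1 / sqrt (2 * pi)) ^ DIM('a) * \<epsilon> * ?B"
    using \<epsilon> by (intro Linf_bounded(2)[OF _ meas]) auto
  then show "Linf_norm (ball 0 r) (fourier (vpot k m \<epsilon>))
      \<le> (1 / sqrt (2 * pi)) ^ DIM('a) * \<epsilon> * exp (r\<^sup>2 / (2 * (1 - 2 * \<alpha>))) * exp (- \<alpha> * (norm k)\<^sup>2)"
    by (simp only: mult.assoc)
qed

section \<open>Failure of logarithmic stability\<close>

text \<open>
  If \<open>\<Phi>\<close> decays like \<open>exp(-\<alpha>n\<^sup>2)\<close>, then \<open>ln(3 + 1/\<Phi>)\<close> grows at least like \<open>n\<^sup>2\<close>, so its power \<open>-\<beta>\<close> is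
  at most of order \<open>n powr (-2 * \<beta>)\<close>, which is negligible against \<open>n\<^sup>-\<^sup>m\<close> exactly because \<open>\<beta> > m/2\<close>.
\<close>

lemma eventually_powr_ln_less:
  fixes \<beta> c a B \<alpha> :: real
  assumes \<beta>: "\<beta> > real m / 2" and c: "c > 0" and a: "a > 0" and B: "B > 0" and \<alpha>: "\<alpha> > 0"
  shows "\<forall>\<^sub>F n in at_top. \<forall>\<Phi>. 0 < \<Phi> \<longrightarrow> \<Phi> \<le> B * exp (- \<alpha> * n\<^sup>2) \<longrightarrow>
      c * ln (3 + inverse \<Phi>) powr (- \<beta>) < a * n powi (- int m)"
proof -
  have lim1: "filterlim (\<lambda>n::real. \<alpha> / 2 * n\<^sup>2) at_top at_top"
    using \<alpha> by (intro filterlim_tendsto_pos_mult_at_top[OF tendsto_const] filterlim_pow_at_top filterlim_ident) auto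
  \<comment> \<open>the quotient of the two sides for \<open>ln (3 + inverse \<Phi>) = \<alpha> / 2 * n\<^sup>2\<close> is \<open>?D / n powr (2 * \<beta> - m)\<close>\<close>
  let ?D = "c * (\<alpha> / 2) powr (- \<beta>) / a"
  have ev1: "\<forall>\<^sub>F n in at_top. \<alpha> / 2 * n\<^sup>2 > ln B" using lim1 by (simp add: filterlim_at_top_dense)
  have ev2: "\<forall>\<^sub>F n in at_top. n powr (2 * \<beta> - real m) > ?D" 
    using eventually_gt_at_top[of "?D powr (1 / (2 * \<beta> - real m))"]
  proof eventually_elim
    case (elim n)
    have "?D = (?D powr (1 / (2 * \<beta> - real m))) powr (2 * \<beta> - real m)"
      unfolding powr_powr using \<beta> a c \<alpha> by simp
    also have "\<dots> < n powr (2 * \<beta> - real m)"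
      using elim \<beta> by (intro powr_less_mono2) auto
    finally show ?case .
  qed
  show ?thesis
    using ev1 ev2 eventually_gt_at_top[of "0::real"]
  proof eventually_elim
    case (elim n)
    show ?case
    proof (intro allI impI)
      fix \<Phi> :: real
      assume \<Phi>: "0 < \<Phi>" "\<Phi> \<le> B * exp (- \<alpha> * n\<^sup>2)"
      have pos: "\<alpha> / 2 * n\<^sup>2 > 0" using \<alpha> elim by simp
      have "ln \<Phi> \<le> ln (B * exp (- \<alpha> * n\<^sup>2))" using \<Phi> B by (subst ln_le_cancel_iff) auto
      also have "\<dots> = ln B - \<alpha> * n\<^sup>2" using B by (simp add: ln_mult)
      finally have "\<alpha> / 2 * n\<^sup>2 \<le> - ln \<Phi>" using elim by simp
      also have "\<dots> = ln (inverse \<Phi>)" using \<Phi> by (simp add: ln_inverse)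
      also have "\<dots> \<le> ln (3 + inverse \<Phi>)" using \<Phi> by (subst ln_le_cancel_iff) (auto intro: add_pos_pos)
      finally have le: "\<alpha> / 2 * n\<^sup>2 \<le> ln (3 + inverse \<Phi>)" .
      have \<beta>0: "\<beta> > 0" using \<beta> by (smt (verit) of_nat_0_le_iff divide_nonneg_nonneg)
      have "ln (3 + inverse \<Phi>) powr (- \<beta>) \<le> (\<alpha> / 2 * n\<^sup>2) powr (- \<beta>)"
        using le pos \<beta>0 by (intro powr_mono2') auto
      also have "\<dots> = (\<alpha> / 2) powr (- \<beta>) * (n powr 2) powr (- \<beta>)"
      proof -
        have "n\<^sup>2 = n powr 2" using elim by simp
        then show ?thesis by (simp only: powr_mult)
      qed
      also have "(n powr 2) powr (- \<beta>) = n powr (- real m) / n powr (2 * \<beta> - real m)"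
        by (subst powr_diff[symmetric], subst powr_powr) simp
      finally have "c * ln (3 + inverse \<Phi>) powr (- \<beta>)
          \<le> c * ((\<alpha> / 2) powr (- \<beta>) * (n powr (- real m) / n powr (2 * \<beta> - real m)))"
        using c by (intro mult_left_mono) auto
      also have "\<dots> = ?D / n powr (2 * \<beta> - real m) * (a * n powr (- real m))"
        using a by simp
      also have "\<dots> < 1 * (a * n powr (- real m))"
        using elim a c \<alpha> by (intro mult_strict_right_mono) (simp_all add: field_simps)
      also have "n powr (- real m) = n powi (- int m)"
        using elim by (simp add: powr_minus powr_realpow power_int_minus)
      finally show "c * ln (3 + inverse \<Phi>) powr (- \<beta>) < a * n powi (- int m)" by simp
    qed
  qed
qed

lemma eventually_norm_at_infinity:
  assumes "eventually P at_top"
  shows "\<forall>\<^sub>F k :: 'a::real_normed_vector in at_infinity. P (norm k)"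
  using filterlim_norm_at_top assms by (auto simp: filterlim_iff)

lemma L2_norm_vpot_ge:
  fixes k :: "'a::euclidean_space"
  assumes "\<epsilon> \<ge> 0"
  shows "\<epsilon> * sqrt (sqrt pi ^ DIM('a) / 2) * norm k powi (- int m) \<le> L2_norm (vpot k m \<epsilon>)"
proof -
  have "sqrt pi ^ DIM('a) * 1 \<le> sqrt pi ^ DIM('a) * (1 + exp (- (norm k)\<^sup>2))"
    by (intro mult_left_mono) auto
  then have "sqrt (sqrt pi ^ DIM('a) / 2) \<le> sqrt (sqrt pi ^ DIM('a) * (1 + exp (- (norm k)\<^sup>2)) / 2)"
    by (intro real_sqrt_le_mono) simp
  then have "\<epsilon> * norm k powi (- int m) * sqrt (sqrt pi ^ DIM('a) / 2)
      \<le> \<epsilon> * norm k powi (- int m) * sqrt (sqrt pi ^ DIM('a) * (1 + exp (- (norm k)\<^sup>2)) / 2)"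
    using assms by (intro mult_left_mono) auto
  then show ?thesis using assms by (simp add: L2_vpot(2) mult_ac)
qed

theorem mainTheorem4:
  shows
    "(\<exists>N' :: real \<Rightarrow> real.
        (\<forall>\<sigma>>1/2. N' \<sigma> > 0 \<and>
           (\<forall>(k :: real ^ 'n) m \<epsilon>. k \<noteq> 0 \<longrightarrow> m > 0 \<longrightarrow> \<epsilon> > 0 \<longrightarrow>
              (\<forall>t\<ge>0. Q (vpot k m \<epsilon>) t
                 \<le> ennreal (\<epsilon> * norm k powi (- int m) * N' \<sigma> * exp (\<sigma> * t\<^sup>2)))))
      \<and> (\<forall>\<sigma>>1/2. \<forall>m>0. \<forall>\<gamma>\<^sub>0>0. \<forall>\<gamma>\<^sub>1>0. \<forall>\<gamma>\<^sub>2>0.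
           \<exists>\<epsilon>\<^sub>0>0. \<forall>\<epsilon>. 0 < \<epsilon> \<and> \<epsilon> < \<epsilon>\<^sub>0 \<longrightarrow> (\<forall>k :: real ^ 'n. norm k > 1 \<longrightarrow>
              \<epsilon> * norm k powi (- int m) * N' \<sigma> \<le> \<gamma>\<^sub>0
            \<and> vpot k m \<epsilon> \<in> W_space m \<and> W_norm m (vpot k m \<epsilon>) \<le> \<gamma>\<^sub>1
            \<and> vpot k m \<epsilon> \<in> H_space m \<and> H_norm m (vpot k m \<epsilon>) \<le> \<gamma>\<^sub>2)))
   \<and> (\<forall>r>0. \<forall>m>0. \<forall>\<epsilon>>0.
        (\<forall>k :: real ^ 'n. k \<noteq> 0 \<longrightarrow> fourier (vpot k m \<epsilon>) \<in> Linf (ball 0 r))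
      \<and> (\<forall>\<alpha>. 0 < \<alpha> \<and> \<alpha> < 1/2 \<longrightarrow>
           (\<lambda>k :: real ^ 'n. Linf_norm (ball 0 r) (fourier (vpot k m \<epsilon>)))
             \<in> O[at_infinity](\<lambda>k. exp (- \<alpha> * (norm k)\<^sup>2)))
      \<and> (\<forall>k :: real ^ 'n. k \<noteq> 0 \<longrightarrow>
           vpot k m \<epsilon> \<in> Linf UNIV \<and> Linf_norm UNIV (vpot k m \<epsilon>) = \<epsilon> * norm k powi (- int m))
      \<and> (\<forall>k :: real ^ 'n. k \<noteq> 0 \<longrightarrow> vpot k m \<epsilon> \<in> L2)
      \<and> is_Omega (\<lambda>k :: real ^ 'n. L2_norm (vpot k m \<epsilon>)) (\<lambda>k. norm k powi (- int m)))
   \<and> (\<forall>r>0. \<forall>m>0. \<forall>\<epsilon>>0. \<forall>\<beta>\<^sub>1 > real m / 2. \<forall>\<beta>\<^sub>2 > real m / 2. \<forall>c\<^sub>1>0. \<forall>c\<^sub>2>0.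
        \<forall>\<^sub>F k :: real ^ 'n in at_infinity.
          Linf_norm UNIV (vpot k m \<epsilon>)
            > c\<^sub>1 * ln (3 + inverse (Linf_norm (ball 0 r) (fourier (vpot k m \<epsilon>)))) powr (- \<beta>\<^sub>1)
        \<and> L2_norm (vpot k m \<epsilon>)
            > c\<^sub>2 * ln (3 + inverse (Linf_norm (ball 0 r) (fourier (vpot k m \<epsilon>)))) powr (- \<beta>\<^sub>2))"
proof (intro conjI)
  define N' where "N' \<sigma> = 1 / (2 * pi) ^ DIM(real ^ 'n) * sqrt (2 * pi / (1 - 1 / (2 * \<sigma>))) ^ DIM(real ^ 'n)" for \<sigma>
  have N'_pos: "N' \<sigma> > 0" if "\<sigma> > 1/2" for \<sigma>
  proof -
    have "1 - 1 / (2 * \<sigma>) > 0" using that by simp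
    then show ?thesis unfolding N'_def by simp
  qed
  have powi_le_1: "x powi (- int m) \<le> 1" if "x \<ge> 1" for x :: real and m :: nat
    using one_le_power[OF that, of m] by (simp add: power_int_minus inverse_le_1_iff)
  show "\<exists>N' :: real \<Rightarrow> real.
        (\<forall>\<sigma>>1/2. N' \<sigma> > 0 \<and>
           (\<forall>(k :: real ^ 'n) m \<epsilon>. k \<noteq> 0 \<longrightarrow> m > 0 \<longrightarrow> \<epsilon> > 0 \<longrightarrow>
              (\<forall>t\<ge>0. Q (vpot k m \<epsilon>) t
                 \<le> ennreal (\<epsilon> * norm k powi (- int m) * N' \<sigma> * exp (\<sigma> * t\<^sup>2)))))
      \<and> (\<forall>\<sigma>>1/2. \<forall>m>0. \<forall>\<gamma>\<^sub>0>0. \<forall>\<gamma>\<^sub>1>0. \<forall>\<gamma>\<^sub>2>0.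
           \<exists>\<epsilon>\<^sub>0>0. \<forall>\<epsilon>. 0 < \<epsilon> \<and> \<epsilon> < \<epsilon>\<^sub>0 \<longrightarrow> (\<forall>k :: real ^ 'n. norm k > 1 \<longrightarrow>
              \<epsilon> * norm k powi (- int m) * N' \<sigma> \<le> \<gamma>\<^sub>0
            \<and> vpot k m \<epsilon> \<in> W_space m \<and> W_norm m (vpot k m \<epsilon>) \<le> \<gamma>\<^sub>1
            \<and> vpot k m \<epsilon> \<in> H_space m \<and> H_norm m (vpot k m \<epsilon>) \<le> \<gamma>\<^sub>2))"
  proof (intro exI[of _ N'] conjI)
    show "\<forall>\<sigma>>1/2. N' \<sigma> > 0 \<and>
           (\<forall>(k :: real ^ 'n) m \<epsilon>. k \<noteq> 0 \<longrightarrow> m > 0 \<longrightarrow> \<epsilon> > 0 \<longrightarrow>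
              (\<forall>t\<ge>0. Q (vpot k m \<epsilon>) t
                 \<le> ennreal (\<epsilon> * norm k powi (- int m) * N' \<sigma> * exp (\<sigma> * t\<^sup>2))))"
      using N'_pos Q_vpot_le[where 'a = "real ^ 'n"] unfolding N'_def by (simp add: less_imp_le)
    show "\<forall>\<sigma>>1/2. \<forall>m>0. \<forall>\<gamma>\<^sub>0>0. \<forall>\<gamma>\<^sub>1>0. \<forall>\<gamma>\<^sub>2>0.
           \<exists>\<epsilon>\<^sub>0>0. \<forall>\<epsilon>. 0 < \<epsilon> \<and> \<epsilon> < \<epsilon>\<^sub>0 \<longrightarrow> (\<forall>k :: real ^ 'n. norm k > 1 \<longrightarrow>
              \<epsilon> * norm k powi (- int m) * N' \<sigma> \<le> \<gamma>\<^sub>0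
            \<and> vpot k m \<epsilon> \<in> W_space m \<and> W_norm m (vpot k m \<epsilon>) \<le> \<gamma>\<^sub>1
            \<and> vpot k m \<epsilon> \<in> H_space m \<and> H_norm m (vpot k m \<epsilon>) \<le> \<gamma>\<^sub>2)"
    proof (intro allI impI)
      fix \<sigma> \<gamma>\<^sub>0 \<gamma>\<^sub>1 \<gamma>\<^sub>2 :: real and m :: nat
      assume \<sigma>: "\<sigma> > 1/2" and m: "m > 0" and \<gamma>: "\<gamma>\<^sub>0 > 0" "\<gamma>\<^sub>1 > 0" "\<gamma>\<^sub>2 > 0"
      obtain C where C: "C > 0"
        and bounds: "\<And>(k :: real ^ 'n) \<epsilon>. norm k > 1 \<Longrightarrow> \<epsilon> > 0 \<Longrightarrow>
          vpot k m \<epsilon> \<in> W_space m \<and> W_norm m (vpot k m \<epsilon>) \<le> \<epsilon> * C \<and>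
          vpot k m \<epsilon> \<in> H_space m \<and> H_norm m (vpot k m \<epsilon>) \<le> \<epsilon> * C"
        using vpot_sobolev_bounds[OF m, where 'a = "real ^ 'n"] by blast
      define \<epsilon>\<^sub>0 where "\<epsilon>\<^sub>0 = min (\<gamma>\<^sub>0 / N' \<sigma>) (min (\<gamma>\<^sub>1 / C) (\<gamma>\<^sub>2 / C))"
      have "\<epsilon>\<^sub>0 > 0" using \<gamma> C N'_pos[OF \<sigma>] by (simp add: \<epsilon>\<^sub>0_def)
      moreover have "\<epsilon> * norm k powi (- int m) * N' \<sigma> \<le> \<gamma>\<^sub>0
            \<and> vpot k m \<epsilon> \<in> W_space m \<and> W_norm m (vpot k m \<epsilon>) \<le> \<gamma>\<^sub>1
            \<and> vpot k m \<epsilon> \<in> H_space m \<and> H_norm m (vpot k m \<epsilon>) \<le> \<gamma>\<^sub>2"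
        if \<epsilon>: "0 < \<epsilon> \<and> \<epsilon> < \<epsilon>\<^sub>0" and k: "norm k > 1" for \<epsilon> and k :: "real ^ 'n"
      proof -
        have "\<epsilon> * N' \<sigma> \<le> \<gamma>\<^sub>0" "\<epsilon> * C \<le> \<gamma>\<^sub>1" "\<epsilon> * C \<le> \<gamma>\<^sub>2"
          using \<epsilon> C N'_pos[OF \<sigma>] by (simp_all add: \<epsilon>\<^sub>0_def pos_less_divide_eq less_imp_le)
        moreover have "\<epsilon> * norm k powi (- int m) * N' \<sigma> \<le> \<epsilon> * 1 * N' \<sigma>"
          using \<epsilon> N'_pos[OF \<sigma>] k by (intro mult_right_mono mult_left_mono powi_le_1) auto
        ultimately have "\<epsilon> * norm k powi (- int m) * N' \<sigma> \<le> \<gamma>\<^sub>0" "\<epsilon> * C \<le> \<gamma>\<^sub>1" "\<epsilon> * C \<le> \<gamma>\<^sub>2"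
          by simp_all
        then show ?thesis using bounds[OF k, of \<epsilon>] \<epsilon> by (meson order_trans)
      qed
      ultimately show "\<exists>\<epsilon>\<^sub>0>0. \<forall>\<epsilon>. 0 < \<epsilon> \<and> \<epsilon> < \<epsilon>\<^sub>0 \<longrightarrow> (\<forall>k :: real ^ 'n. norm k > 1 \<longrightarrow>
              \<epsilon> * norm k powi (- int m) * N' \<sigma> \<le> \<gamma>\<^sub>0
            \<and> vpot k m \<epsilon> \<in> W_space m \<and> W_norm m (vpot k m \<epsilon>) \<le> \<gamma>\<^sub>1
            \<and> vpot k m \<epsilon> \<in> H_space m \<and> H_norm m (vpot k m \<epsilon>) \<le> \<gamma>\<^sub>2)"
        by blast
    qed
  qed
next
  show "\<forall>r>0. \<forall>m>0. \<forall>\<epsilon>>0.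
        (\<forall>k :: real ^ 'n. k \<noteq> 0 \<longrightarrow> fourier (vpot k m \<epsilon>) \<in> Linf (ball 0 r))
      \<and> (\<forall>\<alpha>. 0 < \<alpha> \<and> \<alpha> < 1/2 \<longrightarrow>
           (\<lambda>k :: real ^ 'n. Linf_norm (ball 0 r) (fourier (vpot k m \<epsilon>)))
             \<in> O[at_infinity](\<lambda>k. exp (- \<alpha> * (norm k)\<^sup>2)))
      \<and> (\<forall>k :: real ^ 'n. k \<noteq> 0 \<longrightarrow>
           vpot k m \<epsilon> \<in> Linf UNIV \<and> Linf_norm UNIV (vpot k m \<epsilon>) = \<epsilon> * norm k powi (- int m))
      \<and> (\<forall>k :: real ^ 'n. k \<noteq> 0 \<longrightarrow> vpot k m \<epsilon> \<in> L2)
      \<and> is_Omega (\<lambda>k :: real ^ 'n. L2_norm (vpot k m \<epsilon>)) (\<lambda>k. norm k powi (- int m))"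
  proof (intro allI impI)
    fix r \<epsilon> :: real and m :: nat
    assume r: "r > 0" and m: "m > 0" and \<epsilon>: "\<epsilon> > 0"
    have "(\<lambda>k :: real ^ 'n. Linf_norm (ball 0 r) (fourier (vpot k m \<epsilon>)))
             \<in> O[at_infinity](\<lambda>k. exp (- \<alpha> * (norm k)\<^sup>2))" if \<alpha>: "\<alpha> < 1/2" for \<alpha>
    proof (rule bigoI)
      show "\<forall>\<^sub>F k :: real ^ 'n in at_infinity. norm (Linf_norm (ball 0 r) (fourier (vpot k m \<epsilon>)))
         \<le> (1 / sqrt (2 * pi)) ^ DIM(real ^ 'n) * \<epsilon> * exp (r\<^sup>2 / (2 * (1 - 2 * \<alpha>)))
             * norm (exp (- \<alpha> * (norm k)\<^sup>2))"
        using eventually_norm_at_infinity[OF eventually_ge_at_top[of "max 1 r"]]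
      proof eventually_elim
        case (elim k)
        then have "k \<noteq> 0" by auto
        with elim fourier_vpot_Linf_ball(2)[OF r \<epsilon>, of k m] fourier_vpot_Linf_ball(3)[OF r \<epsilon>, of k \<alpha> m] \<alpha>
        show ?case by auto
      qed
    qed
    moreover have "is_Omega (\<lambda>k :: real ^ 'n. L2_norm (vpot k m \<epsilon>)) (\<lambda>k. norm k powi (- int m))"
      unfolding is_Omega_def
    proof (intro conjI allI impI)
      show "L2_norm (vpot k m \<epsilon>) > 0" if "k \<noteq> 0" for k :: "real ^ 'n"
      proof -
        have "0 < \<epsilon> * sqrt (sqrt pi ^ DIM(real ^ 'n) / 2) * norm k powi (- int m)"
          using that \<epsilon> by simp
        also have "\<dots> \<le> L2_norm (vpot k m \<epsilon>)" using \<epsilon> by (intro L2_norm_vpot_ge) simp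
        finally show ?thesis .
      qed
      let ?c = "\<epsilon> * sqrt (sqrt pi ^ DIM(real ^ 'n) / 2)"
      have c: "?c > 0" using \<epsilon> by simp
      have "norm (norm k powi (- int m)) \<le> inverse ?c * norm (L2_norm (vpot k m \<epsilon>))" for k :: "real ^ 'n"
      proof -
        have "?c * norm k powi (- int m) \<le> L2_norm (vpot k m \<epsilon>)" using \<epsilon> by (intro L2_norm_vpot_ge) simp
        then have "norm k powi (- int m) \<le> L2_norm (vpot k m \<epsilon>) / ?c"
          using c by (subst pos_le_divide_eq) (simp_all only: mult.commute)
        then show ?thesis by (simp only: real_norm_def abs_of_nonneg L2_norm_nonneg zero_le_power_int norm_ge_zero
              divide_inverse mult.commute)
      qed
      then show "(\<lambda>k :: real ^ 'n. norm k powi (- int m)) \<in> O[at_infinity](\<lambda>k. L2_norm (vpot k m \<epsilon>))"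
        by (intro bigoI always_eventually allI)
    qed
    ultimately show "(\<forall>k :: real ^ 'n. k \<noteq> 0 \<longrightarrow> fourier (vpot k m \<epsilon>) \<in> Linf (ball 0 r))
      \<and> (\<forall>\<alpha>. 0 < \<alpha> \<and> \<alpha> < 1/2 \<longrightarrow>
           (\<lambda>k :: real ^ 'n. Linf_norm (ball 0 r) (fourier (vpot k m \<epsilon>)))
             \<in> O[at_infinity](\<lambda>k. exp (- \<alpha> * (norm k)\<^sup>2)))
      \<and> (\<forall>k :: real ^ 'n. k \<noteq> 0 \<longrightarrow>
           vpot k m \<epsilon> \<in> Linf UNIV \<and> Linf_norm UNIV (vpot k m \<epsilon>) = \<epsilon> * norm k powi (- int m))
      \<and> (\<forall>k :: real ^ 'n. k \<noteq> 0 \<longrightarrow> vpot k m \<epsilon> \<in> L2)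
      \<and> is_Omega (\<lambda>k :: real ^ 'n. L2_norm (vpot k m \<epsilon>)) (\<lambda>k. norm k powi (- int m))"
      using \<epsilon> by (simp add: fourier_vpot_Linf_ball(1)[OF r \<epsilon>] Linf_norm_vpot L2_vpot(1))
  qed
next
  show "\<forall>r>0. \<forall>m>0. \<forall>\<epsilon>>0. \<forall>\<beta>\<^sub>1 > real m / 2. \<forall>\<beta>\<^sub>2 > real m / 2. \<forall>c\<^sub>1>0. \<forall>c\<^sub>2>0.
        \<forall>\<^sub>F k :: real ^ 'n in at_infinity.
          Linf_norm UNIV (vpot k m \<epsilon>)
            > c\<^sub>1 * ln (3 + inverse (Linf_norm (ball 0 r) (fourier (vpot k m \<epsilon>)))) powr (- \<beta>\<^sub>1)
        \<and> L2_norm (vpot k m \<epsilon>)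
            > c\<^sub>2 * ln (3 + inverse (Linf_norm (ball 0 r) (fourier (vpot k m \<epsilon>)))) powr (- \<beta>\<^sub>2)"
  proof (intro allI impI)
    fix r \<epsilon> \<beta>\<^sub>1 \<beta>\<^sub>2 c\<^sub>1 c\<^sub>2 :: real and m :: nat
    assume r: "r > 0" and m: "m > 0" and \<epsilon>: "\<epsilon> > 0" and \<beta>: "\<beta>\<^sub>1 > real m / 2" "\<beta>\<^sub>2 > real m / 2"
      and c: "c\<^sub>1 > 0" "c\<^sub>2 > 0"
    \<comment> \<open>any decay rate below \<open>1/2\<close> serves here; \<open>1/4\<close> is one\<close>
    let ?B = "(1 / sqrt (2 * pi)) ^ DIM(real ^ 'n) * \<epsilon> * exp (r\<^sup>2 / (2 * (1 - 2 * (1/4))))"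
    let ?c = "\<epsilon> * sqrt (sqrt pi ^ DIM(real ^ 'n) / 2)"
    have B: "?B > 0" and c': "?c > 0" using \<epsilon> by simp_all
    have ev1: "\<forall>\<^sub>F k :: real ^ 'n in at_infinity. \<forall>\<Phi>. 0 < \<Phi> \<longrightarrow> \<Phi> \<le> ?B * exp (- (1/4) * (norm k)\<^sup>2) \<longrightarrow>
        c\<^sub>1 * ln (3 + inverse \<Phi>) powr (- \<beta>\<^sub>1) < \<epsilon> * norm k powi (- int m)"
      by (intro eventually_norm_at_infinity eventually_powr_ln_less \<beta> c \<epsilon> B) simp
    have ev2: "\<forall>\<^sub>F k :: real ^ 'n in at_infinity. \<forall>\<Phi>. 0 < \<Phi> \<longrightarrow> \<Phi> \<le> ?B * exp (- (1/4) * (norm k)\<^sup>2) \<longrightarrow>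
        c\<^sub>2 * ln (3 + inverse \<Phi>) powr (- \<beta>\<^sub>2) < ?c * norm k powi (- int m)"
      by (intro eventually_norm_at_infinity eventually_powr_ln_less \<beta> c c' B) simp
    show "\<forall>\<^sub>F k :: real ^ 'n in at_infinity.
          Linf_norm UNIV (vpot k m \<epsilon>)
            > c\<^sub>1 * ln (3 + inverse (Linf_norm (ball 0 r) (fourier (vpot k m \<epsilon>)))) powr (- \<beta>\<^sub>1)
        \<and> L2_norm (vpot k m \<epsilon>)
            > c\<^sub>2 * ln (3 + inverse (Linf_norm (ball 0 r) (fourier (vpot k m \<epsilon>)))) powr (- \<beta>\<^sub>2)"
      using ev1 ev2 eventually_norm_at_infinity[OF eventually_ge_at_top[of "max 1 r"]]
    proof eventually_elim
      case (elim k)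
      let ?\<Phi> = "Linf_norm (ball 0 r) (fourier (vpot k m \<epsilon>))"
      have k: "k \<noteq> 0" "norm k \<ge> r" "norm k \<ge> 1" using elim(3) by auto
      have \<Phi>: "?\<Phi> > 0" "?\<Phi> \<le> ?B * exp (- (1/4) * (norm k)\<^sup>2)"
        using fourier_vpot_Linf_ball(2)[OF r \<epsilon> k(1)] fourier_vpot_Linf_ball(3)[OF r \<epsilon> k, of "1/4"]
        by simp_all
      have "c\<^sub>1 * ln (3 + inverse ?\<Phi>) powr (- \<beta>\<^sub>1) < \<epsilon> * norm k powi (- int m)"
        by (rule elim(1)[rule_format, OF \<Phi>])
      also have "\<dots> = Linf_norm UNIV (vpot k m \<epsilon>)"
        using \<epsilon> by (simp add: Linf_norm_vpot(2))
      finally have "c\<^sub>1 * ln (3 + inverse ?\<Phi>) powr (- \<beta>\<^sub>1) < Linf_norm UNIV (vpot k m \<epsilon>)" .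
      moreover have "c\<^sub>2 * ln (3 + inverse ?\<Phi>) powr (- \<beta>\<^sub>2) < L2_norm (vpot k m \<epsilon>)"
      proof (rule less_le_trans)
        show "c\<^sub>2 * ln (3 + inverse ?\<Phi>) powr (- \<beta>\<^sub>2) < ?c * norm k powi (- int m)"
          by (rule elim(2)[rule_format, OF \<Phi>])
        show "?c * norm k powi (- int m) \<le> L2_norm (vpot k m \<epsilon>)"
          using \<epsilon> by (intro L2_norm_vpot_ge) simp
      qed
      ultimately show ?case by blast
    qed
  qed
qed

end
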